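(* Let $n\ge 1$ be an integer and let $\mathfrak{T}$ be a dyadic partition of $\mathbb{T}^n=[0,1]^n$. Let $q>0$ and $p$ satisfy $0<\max(q,1)\le p\le\infty$, and let $$0<\lambda<\frac nq,\qquad 0\le\gamma\le\frac np,\qquad 0<\alpha=\gamma-\lambda+\frac nq<\frac np .$$ Let $p'$ be the conjugate exponent of $p$. Then there is a constant $c$ depending only on $n,\lambda,q,\alpha,p$ such that for all $f\in M_p^\gamma(\mathbb{T}^n)$ and $g\in LM_{p',\infty}^{-\alpha}(\mathfrak{T})$ one has $f*g\in M_q^\lambda(\mathbb{T}^n)$ and $$\|f*g\|_{M_q^\lambda(\mathbb{T}^n)}\le c\,\|f\|_{M_p^\gamma(\mathbb{T}^n)}\,\|g\|_{LM_{p',\infty}^{-\alpha}(\mathfrak{T})}.$$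
   Context: $\mathbb{T}^n=[0,1]^n$ is the unit cube. Functions on $\mathbb{T}^n$ are extended $1$-periodically in each variable when forming the convolution $(f*g)(x)=\int_{\mathbb{T}^n}f(x-y)g(y)\,dy$. The conjugate exponent $p'$ is defined by $\frac1p+\frac1{p'}=1$, and $n/\infty=0$. Morrey space: for $0<p\le\infty$ and $0\le\lambda\le n/p$, $M_p^\lambda(\mathbb{T}^n)$ is the set of measurable $f\in L_p^{\mathrm{loc}}(\mathbb{T}^n)$ with $$\|f\|_{M_p^\lambda(\mathbb{T}^n)}=\sup_{x\in\mathbb{T}^n}\sup_{r>0}r^{-\lambda}\|f\|_{L_p(Q_r(x)\cap\mathbb{T}^n)}<\infty,$$ where $Q_r(x)$ is the cube with centre $x$ and radius $r$. For exponents below $1$ this is a quasi-norm. Dyadic cubes: for $k=0,1,2,\dots$, $G_k$ is the collection of cubes $2^{-k}m+[0,2^{-k})^n$ with $m=(m_1,\dots,m_n)$, $m_i\in\{0,1,\dots,2^k-1\}$, and $G=\bigcup_{k\ge0}G_k$. A dyadic partition of $\mathbb{T}^n$ is a set $\mathfrak{T}\subset G$ of pairwise disjoint cubes whose union covers $\mathbb{T}^n$ up to a set of Lebesgue measure zero. Put $\mathfrak{T}_k=\mathfrak{T}\cap G_k$. Local Morrey space: for $\lambda\in\mathbb{R}$, $0<p,q\le\infty$, $LM_{p,q}^\lambda(\mathfrak{T})$ is the set of measurable functions $f$ on $\mathbb{T}^n$ with $$\|f\|_{LM_{p,q}^\lambda(\mathfrak{T})}=\Bigl(\sum_{k=0}^\infty\Bigl(2^{k\lambda}\sum_{Q\in\mathfrak{T}_k}\|f\|_{L_p(Q)}\Bigr)^q\Bigr)^{1/q}<\infty,$$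 with the sum over $k$ replaced by a supremum when $q=\infty$. In particular $\|g\|_{LM_{p',\infty}^{-\alpha}(\mathfrak{T})}=\sup_{k\ge0}2^{-k\alpha}\sum_{Q\in\mathfrak{T}_k}\|g\|_{L_{p'}(Q)}$. *)

theory Defs
  imports "HOL-Probability.Essential_Supremum"
begin

definition ennpowr :: "ennreal \<Rightarrow> real \<Rightarrow> ennreal" where
  "ennpowr x r = (if x = \<infinity> then \<infinity> else ennreal (enn2real x powr r))"
  (* only used with exponents r > 0 *)

text \<open>Integrability exponents are elements of \<^typ>\<open>ereal\<close>, so that the value infinity is
  covered and dividing a real number by it gives 0. For p below 1 the following
  is a quasi-norm; it takes the value infinity off the space.\<close>

definition Lp_norm :: "ereal \<Rightarrow> 'a measure \<Rightarrow> ('a \<Rightarrow> complex) \<Rightarrow> ennreal" where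
  "Lp_norm p M f =
     (if p = \<infinity> then esssup M (\<lambda>x. ennreal (norm (f x)))
      else ennpowr (\<integral>\<^sup>+ x. ennreal (norm (f x) powr real_of_ereal p) \<partial>M) (1 / real_of_ereal p))"

definition torus_cube :: "(real ^ 'n) set" where
  "torus_cube = cbox 0 1"

text \<open>A function on the unit cube is a function on the whole space of which only the
  values on the cube matter. The periodic extension reads off the values on the
  half-open cube; this differs from the closed one by a null set.\<close>

definition periodic_ext :: "(real ^ 'n \<Rightarrow> complex) \<Rightarrow> real ^ 'n \<Rightarrow> complex" where
  "periodic_ext f x = f (\<chi> i. frac (x $ i))"

definition torus_conv_integrand ::
  "(real ^ 'n \<Rightarrow> complex) \<Rightarrow> (real ^ 'n \<Rightarrow> complex) \<Rightarrow> real ^ 'n \<Rightarrow> real ^ 'n \<Rightarrow> complex" where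
  "torus_conv_integrand f g x y = periodic_ext f (x - y) * g y"

definition torus_conv ::
  "(real ^ 'n \<Rightarrow> complex) \<Rightarrow> (real ^ 'n \<Rightarrow> complex) \<Rightarrow> real ^ 'n \<Rightarrow> complex" where
  "torus_conv f g x = (LINT y|lebesgue_on torus_cube. torus_conv_integrand f g x y)"

text \<open>The Bochner integral has the value 0 where the integrand is not integrable, so
  existence of the convolution has to be stated separately.\<close>

definition torus_conv_exists ::
  "(real ^ 'n \<Rightarrow> complex) \<Rightarrow> (real ^ 'n \<Rightarrow> complex) \<Rightarrow> bool" where
  "torus_conv_exists f g \<longleftrightarrow>
     (AE x in lebesgue_on torus_cube.
        integrable (lebesgue_on torus_cube) (torus_conv_integrand f g x))"

definition centred_cube :: "real \<Rightarrow> real ^ 'n \<Rightarrow> (real ^ 'n) set" where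
  "centred_cube r x = {y. \<forall>i. \<bar>y $ i - x $ i\<bar> \<le> r}"

definition Lp_loc :: "ereal \<Rightarrow> (real ^ 'n \<Rightarrow> complex) set" where
  "Lp_loc p = {f \<in> borel_measurable (lebesgue_on torus_cube).
     \<forall>K. compact K \<and> K \<subseteq> torus_cube \<longrightarrow> Lp_norm p (lebesgue_on K) f < \<infinity>}"

definition morrey_norm :: "ereal \<Rightarrow> real \<Rightarrow> (real ^ 'n \<Rightarrow> complex) \<Rightarrow> ennreal" where
  "morrey_norm p l f =
     (SUP x\<in>torus_cube. SUP r\<in>{0<..}.
        ennreal (r powr (- l)) * Lp_norm p (lebesgue_on (centred_cube r x \<inter> torus_cube)) f)"

definition morrey_space :: "ereal \<Rightarrow> real \<Rightarrow> (real ^ 'n \<Rightarrow> complex) set" where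
  "morrey_space p l = {f \<in> Lp_loc p. morrey_norm p l f < \<infinity>}"

definition dyadic_cube :: "nat \<Rightarrow> ('n \<Rightarrow> nat) \<Rightarrow> (real ^ 'n) set" where
  "dyadic_cube k m =
     {x. \<forall>i. real (m i) / 2 ^ k \<le> x $ i \<and> x $ i < real (m i) / 2 ^ k + 1 / 2 ^ k}"

definition dyadic_level :: "nat \<Rightarrow> (real ^ 'n) set set" where
  "dyadic_level k = {dyadic_cube k m | m. \<forall>i. m i < 2 ^ k}"

definition dyadic_partition :: "(real ^ 'n) set set \<Rightarrow> bool" where
  "dyadic_partition T \<longleftrightarrow>
     T \<subseteq> (\<Union>k. dyadic_level k) \<and> pairwise disjnt T \<and> torus_cube - \<Union>T \<in> null_sets lebesgue"

definition local_morrey_term ::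
  "ereal \<Rightarrow> real \<Rightarrow> (real ^ 'n) set set \<Rightarrow> (real ^ 'n \<Rightarrow> complex) \<Rightarrow> nat \<Rightarrow> ennreal" where
  "local_morrey_term p l T f k =
     ennreal (2 powr (real k * l)) * (\<Sum>Q\<in>T \<inter> dyadic_level k. Lp_norm p (lebesgue_on Q) f)"

definition local_morrey_norm ::
  "ereal \<Rightarrow> ereal \<Rightarrow> real \<Rightarrow> (real ^ 'n) set set \<Rightarrow> (real ^ 'n \<Rightarrow> complex) \<Rightarrow> ennreal" where
  "local_morrey_norm p q l T f =
     (if q = \<infinity> then (SUP k. local_morrey_term p l T f k)
      else ennpowr (\<Sum>k. ennpowr (local_morrey_term p l T f k) (real_of_ereal q))
             (1 / real_of_ereal q))"

definition local_morrey_space ::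
  "ereal \<Rightarrow> ereal \<Rightarrow> real \<Rightarrow> (real ^ 'n) set set \<Rightarrow> (real ^ 'n \<Rightarrow> complex) set" where
  "local_morrey_space p q l T =
     {f \<in> borel_measurable (lebesgue_on torus_cube). local_morrey_norm p q l T f < \<infinity>}"

end

theory Submission
  imports Defs
begin

text \<open>
  Majorise \<open>f * g\<close> pointwise by \<open>h(x) = \<integral> \<bar>f(x - y)\<bar> \<bar>g(y)\<bar> dy\<close>, let \<open>A\<close> and \<open>B\<close> bound the norms of
  \<open>f\<close> and \<open>g\<close>, and put \<open>\<mu> = n/q - \<lambda> = \<alpha> - \<gamma> > 0\<close> and \<open>\<delta> = n/p - \<alpha> > 0\<close>. It suffices to bound the
  integral of \<open>h\<^sup>q\<close> over cubes of dyadic radius \<open>R = 2\<^bsup>-K\<^esup>\<close> by a multiple of \<open>(A B R\<^bsup>\<lambda>\<^esup>)\<^sup>q\<close>.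

  On a cube \<open>Q\<close> of the partition of side \<open>2\<^bsup>-k\<^esup>\<close>, Hoelder's inequality bounds the contribution of \<open>Q\<close>
  to \<open>h(x)\<close> by \<open>\<parallel>g\<parallel>\<^bsub>p',Q\<^esub>\<close> times the \<open>L\<^sub>p\<close> norm of \<open>f\<close> over \<open>x - Q\<close>. The scale \<open>k\<close> is then treated in
  one of two ways, according to its size relative to \<open>R\<close>.
  For coarse scales, \<open>k < K\<close>, the Morrey norm gives the uniform bound \<open>A 2\<^bsup>-k\<gamma>\<^esup>\<close> for the norm of \<open>f\<close>, so
  that level \<open>k\<close> contributes at most a multiple of \<open>A B 2\<^bsup>k\<mu>\<^esup>\<close>; this sums to \<open>A B R\<^bsup>-\<mu>\<^esup>\<close> since \<open>\<mu> > 0\<close>.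
  For fine scales, \<open>k \<ge> K\<close>, one integrates over the cube of radius \<open>R\<close> first: by Tonelli, the \<open>p\<close>-th
  power of the norm of \<open>f\<close> over \<open>x - Q\<close> has integral at most a multiple of \<open>2\<^bsup>-kn\<^esup> A\<^sup>p R\<^bsup>\<gamma>p\<^esup>\<close>. The resulting
  weights \<open>B 2\<^bsup>-k\<delta>\<^esup>\<close> are summable since \<open>\<delta> > 0\<close>. Both halves are balanced at the same height
  \<open>A B R\<^bsup>-\<mu>\<^esup>\<close>, and \<open>(A B R\<^bsup>-\<mu>\<^esup>)\<^sup>q R\<^sup>n = (A B R\<^bsup>\<lambda>\<^esup>)\<^sup>q\<close>.

  Hoelder's inequality is used throughout in the additive form \<open>nn_integral_mult_le_Lp_norm\<close> with a
  free parameter. Summing over cubes and levels is then linear, so that Minkowski's inequality is never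
  invoked; the parameter is optimised once, after summation, in \<open>ennpowr_le_of_splitting\<close>, which also
  turns the \<open>p\<close>-th powers into \<open>q\<close>-th powers and treats \<open>q < 1\<close> and \<open>q \<ge> 1\<close> alike. The estimate of \<open>h\<close>
  is \<open>nn_integral_majorant_powr_le\<close>. To apply Tonelli and to obtain measurability of \<open>f * g\<close>, the functions
  are replaced by Borel representatives, which changes \<open>f * g\<close> at no point.
\<close>

section \<open>Hoelder's inequality with a parameter\<close>

lemma ennpowr_ennreal: "0 \<le> a \<Longrightarrow> ennpowr (ennreal a) r = ennreal (a powr r)"
  by (simp add: ennpowr_def)

lemma ennpowr_mono:
  assumes "x \<le> y" "0 \<le> r"
  shows "ennpowr x r \<le> ennpowr y r"
proof (cases "y = \<infinity>")
  case False
  with assms have "x \<noteq> \<infinity>" by (auto simp: top_unique)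
  have "enn2real x \<le> enn2real y"
    using False assms(1) by (intro enn2real_mono) (auto simp: less_top)
  then show ?thesis
    using False \<open>x \<noteq> \<infinity>\<close> assms by (auto simp: ennpowr_def intro!: ennreal_leI powr_mono2)
qed (simp add: ennpowr_def)

text \<open>Minimising the right-hand side over \<open>s\<close> would give back Hoelder's inequality up to a factor. The
  additive form is kept because it is linear in the \<open>p\<close>-th powers of \<open>u\<close>, so that it can be summed over
  many sets with a common parameter, and that parameter chosen at the end.\<close>
lemma nn_integral_mult_le_Lp_norm:
  fixes u :: "'a \<Rightarrow> real" and v :: "'a \<Rightarrow> complex" and p s :: real and p' :: ereal
  assumes u[measurable]: "u \<in> borel_measurable M" and v[measurable]: "v \<in> borel_measurable M"
    and nonneg: "\<And>x. 0 \<le> u x" and p: "1 \<le> p" and p': "1 \<le> p'" "1 / ereal p + 1 / p' = 1" and s: "0 < s"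
  shows "(\<integral>\<^sup>+ x. ennreal (u x * norm (v x)) \<partial>M)
    \<le> Lp_norm p' M v * (ennreal s + ennreal (s powr (1 - p)) * (\<integral>\<^sup>+ x. ennreal (u x powr p) \<partial>M))"
proof (cases "p = 1")
  case True
  have "p' = \<infinity>"
    using p' True by (cases p') (auto simp: one_ereal_def)
  \<comment> \<open>At this endpoint the power of \<open>s\<close> is \<open>1\<close>, and the summand \<open>s\<close> is simply discarded.\<close>
  have "AE x in M. ennreal (norm (v x)) \<le> Lp_norm p' M v"
    unfolding Lp_norm_def using \<open>p' = \<infinity>\<close> esssup_AE[of "\<lambda>x. ennreal (norm (v x))" M] by simp
  then have "(\<integral>\<^sup>+ x. ennreal (u x * norm (v x)) \<partial>M) \<le> (\<integral>\<^sup>+ x. Lp_norm p' M v * ennreal (u x) \<partial>M)"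
    by (intro nn_integral_mono_AE)
       (auto simp: ennreal_mult nonneg mult.commute elim!: eventually_mono intro!: mult_left_mono)
  also have "\<dots> = Lp_norm p' M v * (\<integral>\<^sup>+ x. ennreal (u x) \<partial>M)"
    by (simp add: nn_integral_cmult)
  also have "\<dots> \<le> Lp_norm p' M v * (ennreal s + ennreal (s powr (1 - p)) * (\<integral>\<^sup>+ x. ennreal (u x powr p) \<partial>M))"
    using True s nonneg by (intro mult_left_mono) auto
  finally show ?thesis .
next
  case False
  then have p1: "1 < p" using p by simp
  obtain r where r: "p' = ereal r" "1 < r" "1 / p + 1 / r = 1"
  proof (cases p')
    case (real r)
    have "1 / p + 1 / r = 1" using p' real p1 by (auto simp: one_ereal_def divide_ereal_def zero_ereal_def inverse_eq_divide split: if_splits)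
    moreover have "r \<noteq> 1" using calculation p1 by (auto simp: field_simps)
    ultimately show ?thesis using that[of r] real p' by (auto simp: one_ereal_def)
  qed (use p' p1 in \<open>auto simp: one_ereal_def\<close>)
  have ps: "(p - 1) / p * r = 1"
    using r p1 by (simp add: field_simps)
  define I where "I = (\<integral>\<^sup>+ x. ennreal (norm (v x) powr r) \<partial>M)"
  have N: "Lp_norm p' M v = ennpowr I (1 / r)"
    using r by (simp add: Lp_norm_def I_def)
  consider "I = \<infinity>" | "I = 0" | i where "0 < i" "I = ennreal i"
    by (metis ennreal_cases infinity_ennreal_def less_eq_real_def ennreal_0)
  then show ?thesis
  proof cases
    case 1
    then show ?thesis using s by (simp add: N ennpowr_def ennreal_top_mult)
  next
    case 2
    then have "AE x in M. ennreal (norm (v x) powr r) = 0"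
      unfolding I_def by (subst (asm) nn_integral_0_iff_AE) auto
    then have "AE x in M. ennreal (u x * norm (v x)) = 0"
      by (auto elim!: eventually_mono)
    then have "(\<integral>\<^sup>+ x. ennreal (u x * norm (v x)) \<partial>M) = 0"
      by (subst nn_integral_0_iff_AE) auto
    then show ?thesis by simp
  next
    case 3
    define c where "c = i powr (1 / r)"
    have c: "0 < c" "c powr r = i" "Lp_norm p' M v = ennreal c"
      using 3(1) r(2) by (auto simp: c_def powr_powr N 3(2) ennpowr_ennreal)
    \<comment> \<open>Young's inequality, applied after normalising \<open>v\<close> and shifting a power of \<open>s\<close> from one factor to the other.\<close>
    have point: "u x * norm (v x) \<le> c * (s powr (1 - p) * (u x powr p) + s / i * norm (v x) powr r)" for x
    proof -
      define a b where "a = u x * s powr ((1 - p) / p)" and "b = norm (v x) / c * s powr ((p - 1) / p)"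
      have "a * b = u x * norm (v x) / c * (s powr ((1 - p) / p) * s powr ((p - 1) / p))"
        by (simp add: a_def b_def)
      also have "s powr ((1 - p) / p) * s powr ((p - 1) / p) = 1"
        using s by (simp flip: powr_add add_divide_distrib)
      finally have ab: "u x * norm (v x) = c * (a * b)" using c by simp
      have "a * b \<le> a powr p / p + b powr r / r"
        using nonneg c p1 r by (intro Youngs_inequality) (auto simp: a_def b_def)
      also have "\<dots> \<le> a powr p / 1 + b powr r / 1"
        using p1 r by (intro add_mono divide_left_mono) auto
      finally have "a * b \<le> a powr p + b powr r" by simp
      moreover have "a powr p = s powr (1 - p) * (u x powr p)"
        using nonneg[of x] p1 by (simp add: a_def powr_mult powr_powr)
      moreover have "b powr r = s / i * norm (v x) powr r"
        using c s ps by (simp add: b_def powr_mult powr_divide powr_powr)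
      ultimately show ?thesis unfolding ab using c by (intro mult_left_mono) auto
    qed
    have "(\<integral>\<^sup>+ x. ennreal (u x * norm (v x)) \<partial>M)
        \<le> (\<integral>\<^sup>+ x. ennreal c * (ennreal (s powr (1 - p)) * ennreal (u x powr p)
              + ennreal (s / i) * ennreal (norm (v x) powr r)) \<partial>M)"
    proof (intro nn_integral_mono)
      fix x
      show "ennreal (u x * norm (v x)) \<le> ennreal c * (ennreal (s powr (1 - p)) * ennreal (u x powr p)
              + ennreal (s / i) * ennreal (norm (v x) powr r))"
        using point[of x] 3 c s by (auto simp flip: ennreal_mult ennreal_plus intro!: ennreal_leI)
    qed
    also have "\<dots> = ennreal c * (ennreal (s powr (1 - p)) * (\<integral>\<^sup>+ x. ennreal (u x powr p) \<partial>M)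
              + ennreal (s / i) * I)"
      by (simp add: nn_integral_cmult nn_integral_add I_def)
    also have "ennreal (s / i) * I = ennreal s"
      using 3 s by (simp flip: ennreal_mult)
    finally show ?thesis by (simp add: c add.commute)
  qed
qed

text \<open>The choice \<open>t = (Z/W)\<^bsup>1/p\<^esup>\<close> balances the last two terms of the hypothesis. Cutting it off below
  at the height \<open>t0\<close> absorbs the constant term and makes \<open>t\<^sup>q\<close> at most \<open>t0\<^sup>q + t0\<^bsup>q-p\<^esup> t\<^sup>p\<close>, because \<open>q \<le> p\<close>. The
  bound is therefore linear in \<open>Z\<close> and can be integrated, whatever the size of \<open>q\<close> relative to \<open>1\<close>.\<close>
lemma ennpowr_le_of_splitting:
  fixes h Z :: ennreal and t0 W C0 p q :: real
  assumes h: "\<And>t. 0 < t \<Longrightarrow> h \<le> ennreal (C0 * W * t0) + ennreal (t * W) + ennreal (t powr (1 - p)) * Z"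
    and "0 < t0" "0 < W" "0 \<le> C0" "0 < q" "q \<le> p" "0 < p"
  shows "ennpowr h q \<le> ennreal (((C0 + 2) * W) powr q) *
            (ennreal (t0 powr q) + ennreal (t0 powr (q - p) / W) * Z)"
proof (cases "Z = \<infinity>")
  case True
  then show ?thesis using assms by (simp add: ennreal_mult_top)
next
  case False
  then obtain z where z: "Z = ennreal z" "0 \<le> z" by (cases Z) auto
  \<comment> \<open>Both lower bounds are used: \<open>(Z/W)\<^bsup>1/p\<^esup> \<le> t\<close> tames the last term, \<open>t0 \<le> t\<close> the constant one.\<close>
  define t where "t = max t0 ((z / W) powr (1 / p))"
  have t: "0 < t" "t0 \<le> t" using assms by (auto simp: t_def)
  have "z / W = ((z / W) powr (1 / p)) powr p"
    using assms z by (simp add: powr_powr)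
  also have "\<dots> \<le> t powr p"
    using assms by (intro powr_mono2) (auto simp: t_def)
  finally have "z \<le> W * t powr p" using assms by (simp add: field_simps)
  then have "t powr (1 - p) * z \<le> t powr (1 - p) * (W * t powr p)"
    by (intro mult_left_mono) auto
  also have "\<dots> = W * t" using t by (simp add: powr_diff)
  finally have tz: "t powr (1 - p) * z \<le> W * t" .
  have "h \<le> ennreal (C0 * W * t0 + t * W + t powr (1 - p) * z)"
    using h[OF t(1)] assms t z by (simp flip: ennreal_mult ennreal_plus)
  also have "C0 * W * t0 + t * W + t powr (1 - p) * z \<le> (C0 + 2) * W * t"
    using tz mult_left_mono[OF t(2), of "C0 * W"] assms by (simp add: algebra_simps)
  finally have "ennpowr h q \<le> ennpowr (ennreal ((C0 + 2) * W * t)) q"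
    using assms by (intro ennpowr_mono) (auto simp: ennreal_leI)
  also have "\<dots> = ennreal (((C0 + 2) * W) powr q * t powr q)"
    using assms t by (subst ennpowr_ennreal) (auto simp: powr_mult)
  also have "t powr q \<le> t0 powr q + t0 powr (q - p) / W * z"
  proof (cases "t = t0")
    case True
    then show ?thesis using z assms by simp
  next
    case False
    then have "t = (z / W) powr (1 / p)" unfolding t_def by linarith
    then have "z / W = t powr p" using assms z by (simp add: powr_powr)
    moreover have "t powr q = t powr (q - p) * t powr p" by (simp flip: powr_add)
    moreover have "t powr (q - p) \<le> t0 powr (q - p)"
      using assms t by (intro powr_mono2') auto
    ultimately have "t powr q \<le> t0 powr (q - p) * (z / W)"
      using assms z by (simp add: mult_right_mono)
    then show ?thesis by (smt (verit) powr_ge_zero times_divide_eq_left times_divide_eq_right)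
  qed
  finally show ?thesis
    using z assms by (simp add: ennreal_leI mult_left_mono flip: ennreal_mult ennreal_plus)
qed

section \<open>Borel representatives and the periodic extension\<close>

lemma nn_integral_lborel_reflect:
  fixes x :: "'a::euclidean_space"
  assumes [measurable]: "h \<in> borel_measurable borel"
  shows "(\<integral>\<^sup>+ y. h (x - y) \<partial>lborel) = (\<integral>\<^sup>+ y. h y \<partial>lborel)"
  by (subst (2) lborel_affine[of "-1" x]) (simp_all add: nn_integral_density nn_integral_distr)

lemma nn_integral_lborel_translate:
  fixes a :: "'a::euclidean_space"
  assumes [measurable]: "h \<in> borel_measurable borel"
  shows "(\<integral>\<^sup>+ y. h (y - a) \<partial>lborel) = (\<integral>\<^sup>+ y. h y \<partial>lborel)"
  by (subst (2) lborel_affine[of 1 "- a"]) (simp_all add: nn_integral_density nn_integral_distr)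

lemma borel_measurable_vec_nth [measurable]: "(\<lambda>x::real ^ 'n. x $ i) \<in> borel_measurable borel"
  by (intro borel_measurable_continuous_onI continuous_on_component continuous_on_id)

lemma borel_measurable_frac_vec [measurable]:
  "(\<lambda>x::real ^ 'n. \<chi> i. frac (x $ i)) \<in> borel_measurable borel"
proof (subst borel_measurable_euclidean_space, safe)
  fix b :: "real ^ 'n" assume "b \<in> Basis"
  then obtain i where b: "b = axis i 1" by (auto simp: Basis_vec_def)
  have "(\<lambda>x::real ^ 'n. frac (x \<bullet> axis i 1)) \<in> borel_measurable borel"
    unfolding frac_def by measurable
  then show "(\<lambda>x::real ^ 'n. (\<chi> i. frac (x $ i)) \<bullet> b) \<in> borel_measurable borel"
    unfolding b by (simp add: inner_axis)
qed

lemma periodic_ext_measurable [measurable]: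
  assumes [measurable]: "f \<in> borel_measurable borel"
  shows "periodic_ext f \<in> borel_measurable borel"
  unfolding periodic_ext_def[abs_def] by measurable

text \<open>Composition with translations and products of measures need Borel, not merely Lebesgue,
  measurable functions.\<close>
lemma borel_representative_on:
  fixes f :: "'a::euclidean_space \<Rightarrow> complex"
  assumes S: "S \<in> sets borel" and f: "f \<in> borel_measurable (lebesgue_on S)"
  obtains f0 where "f0 \<in> borel_measurable borel" "AE x in lborel. x \<in> S \<longrightarrow> f x = f0 x"
proof -
  define g where "g x = (if x \<in> S then f x else 0)" for x
  have [measurable]: "g \<in> borel_measurable lebesgue"
    unfolding g_def using f S by (intro borel_measurable_if_I) auto
  have "(\<lambda>x. Re (g x)) \<in> borel_measurable lebesgue" "(\<lambda>x. Im (g x)) \<in> borel_measurable lebesgue"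
    by measurable
  from this[THEN completion_ex_borel_measurable_real] obtain a b
    where ab: "a \<in> borel_measurable lborel" "b \<in> borel_measurable lborel"
      "AE x in lborel. Re (g x) = a x" "AE x in lborel. Im (g x) = b x"
    by blast
  show ?thesis
  proof (rule that)
    show "(\<lambda>x. complex_of_real (a x) + \<i> * complex_of_real (b x)) \<in> borel_measurable borel"
      using ab by simp
    show "AE x in lborel. x \<in> S \<longrightarrow> f x = complex_of_real (a x) + \<i> * complex_of_real (b x)"
      using ab(3,4) by eventually_elim (auto simp: g_def complex_eq_iff)
  qed
qed

lemma frac_vec_mem_torus_cube: "(\<chi> i. frac (x $ i)) \<in> torus_cube"
  by (auto simp: torus_cube_def mem_box_cart less_imp_le[OF frac_lt_1])

text \<open>The exceptional set is contained in the countable union of the integer translates of a null set,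
  reflected at \<open>x\<close>. It is a null set for every \<open>x\<close>, not just for almost every \<open>x\<close>.\<close>
lemma AE_periodic_ext_reflect_eq:
  fixes f f0 :: "real ^ 'n \<Rightarrow> complex"
  assumes "AE x in lborel. x \<in> torus_cube \<longrightarrow> f x = f0 x"
  shows "AE y in lborel. periodic_ext f (x - y) = periodic_ext f0 (x - y)"
proof -
  obtain N where N: "N \<in> null_sets lborel" "\<And>z. z \<in> torus_cube \<Longrightarrow> f z \<noteq> f0 z \<Longrightarrow> z \<in> N"
    using assms unfolding eventually_ae_filter by auto
  define U :: "(real ^ 'n) set" where "U = (\<Union>m::'n \<Rightarrow> int. {z. z - (\<chi> i. of_int (m i)) \<in> N})"
  have U: "U \<in> null_sets lborel"
    unfolding U_def by (intro null_sets_UN null_sets_translation N)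
  then have [measurable]: "U \<in> sets borel" by auto
  have "emeasure lborel {y. x - y \<in> U} = (\<integral>\<^sup>+ y. indicator {y. x - y \<in> U} y \<partial>lborel)"
    by (rule nn_integral_indicator[symmetric]) simp
  also have "\<dots> = (\<integral>\<^sup>+ y. indicator U (x - y) \<partial>lborel)"
    by (simp add: indicator_def)
  also have "\<dots> = 0"
    using U by (subst nn_integral_lborel_reflect) auto
  finally have "AE y in lborel. y \<notin> {y. x - y \<in> U}"
    by (intro AE_not_in null_setsI) auto
  then show ?thesis
  proof (eventually_elim)
    case (elim y)
    let ?z = "x - y"
    have "(\<chi> i. frac (?z $ i)) = ?z - (\<chi> i. of_int \<lfloor>?z $ i\<rfloor>)"
      by (simp add: vec_eq_iff frac_def)
    moreover have "?z - (\<chi> i. of_int (m i)) \<notin> N" for m :: "'n \<Rightarrow> int"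
      using elim by (auto simp: U_def)
    ultimately have "(\<chi> i. frac (?z $ i)) \<notin> N" by metis
    then show ?case
      using N(2) frac_vec_mem_torus_cube unfolding periodic_ext_def by blast
  qed
qed

lemma dyadic_cube_borel [measurable]: "dyadic_cube k m \<in> sets borel"
  unfolding dyadic_cube_def by measurable

lemma torus_cube_borel [measurable]: "torus_cube \<in> sets borel"
  unfolding torus_cube_def by simp

lemma centred_cube_borel [measurable]: "centred_cube r x \<in> sets borel"
  unfolding centred_cube_def by measurable

text \<open>A set of sup-diameter at most \<open>2\<close> meets at most five unit intervals in each coordinate direction. Cut it
  along the integer lattice and translate each piece back into the unit cube, where it fits into a
  cube centred at any of its own points. Thus \<open>D\<close>, which only concerns cubes centred in the torus
  cube, controls the integral over sets in arbitrary position.\<close>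
lemma nn_integral_periodic_ext_le:
  fixes f :: "real ^ 'n \<Rightarrow> complex" and E :: "(real ^ 'n) set"
  assumes [measurable]: "f \<in> borel_measurable borel" "E \<in> sets borel"
    and D: "\<And>z. z \<in> torus_cube \<Longrightarrow>
      (\<integral>\<^sup>+ w. ennreal (norm (f w) powr p) * indicator (centred_cube s z \<inter> torus_cube) w \<partial>lborel) \<le> D"
    and E: "\<And>a b i. a \<in> E \<Longrightarrow> b \<in> E \<Longrightarrow> \<bar>a $ i - b $ i\<bar> \<le> s" and s: "s \<le> 2"
  shows "(\<integral>\<^sup>+ x. ennreal (norm (periodic_ext f x) powr p) * indicator E x \<partial>lborel) \<le> ennreal (5 ^ CARD('n)) * D"
proof (cases "E = {}")
  case False
  then obtain a where a: "a \<in> E" by blast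
  define M where "M = (UNIV :: 'n set) \<rightarrow>\<^sub>E {-2..2::int}"
  have M: "finite M" "card M = 5 ^ CARD('n)"
    unfolding M_def by (auto intro: finite_PiE simp: card_funcsetE)
  \<comment> \<open>The lattice points are counted from the cell of \<open>a\<close>, so that one finite index set serves every position of \<open>E\<close>.\<close>
  define t :: "('n \<Rightarrow> int) \<Rightarrow> real ^ 'n" where "t m = (\<chi> i. of_int (\<lfloor>a $ i\<rfloor> + m i))" for m
  define U :: "(real ^ 'n) set" where "U = {z. \<forall>i. 0 \<le> z $ i \<and> z $ i < 1}"
  have U[measurable]: "U \<in> sets borel" "U \<subseteq> torus_cube"
    unfolding U_def by (measurable, auto simp: torus_cube_def mem_box_cart less_imp_le)
  define F where "F m w = ennreal (norm (f w) powr p) * indicator U w * indicator E (w + t m)" for m w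
  have [measurable]: "F m \<in> borel_measurable borel" for m
    unfolding F_def by measurable
  have piece: "(\<integral>\<^sup>+ w. F m w \<partial>lborel) \<le> D" for m
  proof (cases "\<exists>z. z \<in> U \<and> z + t m \<in> E")
    case True
    then obtain z where z: "z \<in> U" "z + t m \<in> E" by blast
    have "F m w \<le> ennreal (norm (f w) powr p) * indicator (centred_cube s z \<inter> torus_cube) w" for w
      using E[OF _ z(2), of "w + t m"] U(2)
      by (auto simp: F_def centred_cube_def split: split_indicator)
    then have "(\<integral>\<^sup>+ w. F m w \<partial>lborel)
        \<le> (\<integral>\<^sup>+ w. ennreal (norm (f w) powr p) * indicator (centred_cube s z \<inter> torus_cube) w \<partial>lborel)"
      by (intro nn_integral_mono)
    also have "\<dots> \<le> D" using z U by (intro D) auto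
    finally show ?thesis .
  next
    case False
    then have "F m w = 0" for w by (auto simp: F_def split: split_indicator)
    then show ?thesis by simp
  qed
  have cover: "ennreal (norm (periodic_ext f x) powr p) * indicator E x \<le> (\<Sum>m\<in>M. F m (x - t m))" for x
  proof (cases "x \<in> E")
    case True
    define m where "m i = \<lfloor>x $ i\<rfloor> - \<lfloor>a $ i\<rfloor>" for i
    have "m i \<in> {-2..2}" for i
      using E[OF True a, of i] s unfolding m_def atLeastAtMost_iff by linarith
    then have "m \<in> M" by (auto simp: M_def)
    have fr: "x - t m = (\<chi> i. frac (x $ i))"
      by (simp add: vec_eq_iff t_def m_def frac_def)
    have "ennreal (norm (periodic_ext f x) powr p) * indicator E x = F m (x - t m)"
      using True by (simp add: F_def fr periodic_ext_def U_def frac_lt_1) (simp add: flip: fr)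
    also have "\<dots> \<le> (\<Sum>m\<in>M. F m (x - t m))"
      using \<open>m \<in> M\<close> M by (intro member_le_sum) auto
    finally show ?thesis .
  qed simp
  have "(\<integral>\<^sup>+ x. ennreal (norm (periodic_ext f x) powr p) * indicator E x \<partial>lborel)
      \<le> (\<integral>\<^sup>+ x. (\<Sum>m\<in>M. F m (x - t m)) \<partial>lborel)"
    by (intro nn_integral_mono cover)
  also have "\<dots> = (\<Sum>m\<in>M. \<integral>\<^sup>+ x. F m x \<partial>lborel)"
    by (subst nn_integral_sum) (auto simp: nn_integral_lborel_translate)
  also have "\<dots> \<le> (\<Sum>m\<in>M. D)"
    by (intro sum_mono piece)
  finally show ?thesis by (simp add: M flip: ennreal_power)
qed simp

section \<open>Dyadic partitions\<close>

lemma finite_dyadic_level: "finite (dyadic_level k :: (real ^ 'n) set set)"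
proof -
  have "finite ((UNIV :: 'n set) \<rightarrow>\<^sub>E {..<2 ^ k :: nat})"
    by (intro finite_PiE) auto
  moreover have "dyadic_level k = dyadic_cube k ` ((UNIV :: 'n set) \<rightarrow>\<^sub>E {..<2 ^ k})"
    by (auto simp: dyadic_level_def PiE_def)
  ultimately show ?thesis by simp
qed

lemma emeasure_centred_cube:
  assumes "0 \<le> r"
  shows "emeasure lborel (centred_cube r (x :: real ^ 'n)) = ennreal ((2 * r) ^ CARD('n))"
proof -
  have cb: "centred_cube r x = cbox (x - (\<chi> i. r)) (x + (\<chi> i. r))"
    by (rule set_eqI) (simp add: centred_cube_def mem_box_cart abs_diff_le_iff)
  have "x \<in> centred_cube r x" using assms by (simp add: centred_cube_def)
  then have "measure lborel (cbox (x - (\<chi> i. r)) (x + (\<chi> i. r))) = (2 * r) ^ CARD('n)"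
    unfolding cb by (subst content_cbox_cart) auto
  then show ?thesis
    unfolding cb using emeasure_lborel_cbox_finite
    by (metis emeasure_eq_ennreal_measure infinity_ennreal_def less_irrefl)
qed

context
  fixes k :: nat and Q :: "(real ^ 'n) set"
  assumes Q: "Q \<in> dyadic_level k"
begin

lemma dyadic_level_borel: "Q \<in> sets borel"
  using Q by (auto simp: dyadic_level_def)

lemma dyadic_level_subset: "Q \<subseteq> torus_cube"
proof
  fix x assume x: "x \<in> Q"
  obtain m where m: "Q = dyadic_cube k m" "\<And>i. m i < 2 ^ k"
    using Q by (auto simp: dyadic_level_def)
  have "0 \<le> x $ i \<and> x $ i \<le> 1" for i
  proof -
    have "real (m i) + 1 \<le> 2 ^ k" using m(2)[of i] by (metis Suc_leI add.commute of_nat_Suc of_nat_le_iff of_nat_numeral of_nat_power)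
    then have "real (m i) / 2 ^ k + 1 / 2 ^ k \<le> 1" by (simp add: field_simps)
    moreover have "0 \<le> real (m i) / 2 ^ k" by simp
    moreover have "real (m i) / 2 ^ k \<le> x $ i \<and> x $ i < real (m i) / 2 ^ k + 1 / 2 ^ k"
      using x unfolding m(1) dyadic_cube_def by blast
    ultimately show ?thesis by linarith
  qed
  then show "x \<in> torus_cube" by (simp add: torus_cube_def mem_box_cart)
qed

lemma dyadic_level_diameter: "x \<in> Q \<Longrightarrow> y \<in> Q \<Longrightarrow> \<bar>x $ i - y $ i\<bar> \<le> 1 / 2 ^ k"
proof -
  assume xy: "x \<in> Q" "y \<in> Q"
  obtain m where m: "Q = dyadic_cube k m"
    using Q by (auto simp: dyadic_level_def)
  show ?thesis
    using xy[unfolded m dyadic_cube_def mem_Collect_eq, THEN spec[of _ i]] by linarith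
qed

lemma emeasure_dyadic_level_le: "emeasure lborel Q \<le> ennreal (1 / 2 ^ (k * CARD('n)))"
proof -
  obtain m where m: "Q = dyadic_cube k m"
    using Q by (auto simp: dyadic_level_def)
  let ?c = "(\<chi> i. real (m i) / 2 ^ k + 1 / 2 ^ k / 2) :: real ^ 'n"
  have half: "\<bar>x - (a + b / 2)\<bar> \<le> b / 2" if "a \<le> x \<and> x < a + b" for a b x :: real
    using that unfolding abs_le_iff by (auto simp: field_simps)
  have "Q \<subseteq> centred_cube (1 / 2 ^ k / 2) ?c"
  proof
    fix x assume "x \<in> Q"
    then have "real (m i) / 2 ^ k \<le> x $ i \<and> x $ i < real (m i) / 2 ^ k + 1 / 2 ^ k" for i
      unfolding m dyadic_cube_def by blast
    from half[OF this] show "x \<in> centred_cube (1 / 2 ^ k / 2) ?c"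
      unfolding centred_cube_def vec_lambda_beta by blast
  qed
  then have "emeasure lborel Q \<le> emeasure lborel (centred_cube (1 / 2 ^ k / 2) ?c)"
    by (intro emeasure_mono) auto
  then show ?thesis
    by (subst (asm) emeasure_centred_cube) (auto simp: power_divide power_mult)
qed

end

lemma nn_integral_lebesgue_on:
  "S \<in> sets borel \<Longrightarrow> (\<integral>\<^sup>+ x. h x \<partial>lebesgue_on S) = (\<integral>\<^sup>+ x. h x * indicator S x \<partial>lborel)"
  by (subst nn_integral_restrict_space) (auto simp: nn_integral_completion)

text \<open>The cubes of the partition cover the torus cube up to a null set.\<close>
lemma nn_integral_dyadic_partition_le:
  fixes h :: "real ^ 'n \<Rightarrow> ennreal"
  assumes T: "dyadic_partition T" and h: "h \<in> borel_measurable (lebesgue_on torus_cube)"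
  shows "(\<integral>\<^sup>+ x. h x \<partial>lebesgue_on torus_cube)
    \<le> (\<Sum>k. \<Sum>Q\<in>T \<inter> dyadic_level k. \<integral>\<^sup>+ x. h x \<partial>lebesgue_on Q)"
proof -
  have mh: "(\<lambda>x. h x * indicator torus_cube x) \<in> borel_measurable lebesgue"
    using h by (subst (asm) borel_measurable_restrict_space_iff_ennreal) auto
  have mQ: "(\<lambda>x. h x * indicator Q x) \<in> borel_measurable lebesgue"
    if "Q \<in> dyadic_level k" for Q k
  proof -
    have [measurable]: "Q \<in> sets lebesgue" using dyadic_level_borel[OF that] by simp
    have "(\<lambda>x. h x * indicator torus_cube x * indicator Q x) \<in> borel_measurable lebesgue"
      using mh by measurable
    also have "(\<lambda>x. h x * indicator torus_cube x * indicator Q x) = (\<lambda>x. h x * indicator Q x)"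
      using dyadic_level_subset[OF that] by (intro ext) (auto split: split_indicator)
    finally show ?thesis .
  qed
  have "AE x in lebesgue. x \<notin> torus_cube - \<Union>T"
    using T by (intro AE_not_in) (simp add: dyadic_partition_def)
  then have "AE x in lebesgue. h x * indicator torus_cube x
      \<le> (\<Sum>k. \<Sum>Q\<in>T \<inter> dyadic_level k. h x * indicator Q x)"
  proof eventually_elim
    case (elim x)
    show ?case
    proof (cases "x \<in> torus_cube")
      case True
      then obtain k Q where Q: "Q \<in> T \<inter> dyadic_level k" "x \<in> Q"
        using elim T unfolding dyadic_partition_def by blast
      have "h x * indicator torus_cube x = h x * indicator Q x" using True Q by simp
      also have "\<dots> \<le> (\<Sum>Q\<in>T \<inter> dyadic_level k. h x * indicator Q x)"
        using Q finite_dyadic_level by (intro member_le_sum) auto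
      also have "\<dots> = (\<Sum>k\<in>{k}. \<Sum>Q\<in>T \<inter> dyadic_level k. h x * indicator Q x)" by simp
      also have "\<dots> \<le> (\<Sum>k. \<Sum>Q\<in>T \<inter> dyadic_level k. h x * indicator Q x)"
        by (intro sum_le_suminf) auto
      finally show ?thesis .
    qed simp
  qed
  then have "(\<integral>\<^sup>+ x. h x * indicator torus_cube x \<partial>lebesgue)
      \<le> (\<integral>\<^sup>+ x. (\<Sum>k. \<Sum>Q\<in>T \<inter> dyadic_level k. h x * indicator Q x) \<partial>lebesgue)"
    by (intro nn_integral_mono_AE)
  also have "\<dots> = (\<Sum>k. \<integral>\<^sup>+ x. (\<Sum>Q\<in>T \<inter> dyadic_level k. h x * indicator Q x) \<partial>lebesgue)"
    using mQ by (intro nn_integral_suminf borel_measurable_sum) blast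
  also have "\<dots> = (\<Sum>k. \<Sum>Q\<in>T \<inter> dyadic_level k. \<integral>\<^sup>+ x. h x * indicator Q x \<partial>lebesgue)"
    using mQ by (intro suminf_cong nn_integral_sum) blast
  also have "\<dots> = (\<Sum>k. \<Sum>Q\<in>T \<inter> dyadic_level k. \<integral>\<^sup>+ x. h x \<partial>lebesgue_on Q)"
    by (intro suminf_cong sum.cong refl, subst nn_integral_lebesgue_on)
       (auto intro: dyadic_level_borel simp: nn_integral_completion)
  finally show ?thesis by (simp add: nn_integral_lebesgue_on nn_integral_completion)
qed

section \<open>The estimate at a dyadic scale\<close>

lemma suminf_geometric_tail:
  fixes d B :: real
  assumes "0 < d" "0 \<le> B"
  shows "(\<Sum>k. if k < K then 0 else ennreal (B * 2 powr (- (real k * d))))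
    = ennreal (B * 2 powr (- (real K * d)) / (1 - 2 powr (- d)))"
proof -
  have pw: "2 powr (- (real k * d)) = (2 powr (- d)) ^ k" for k
    by (simp add: powr_powr mult.commute flip: powr_realpow)
  have lt: "2 powr (- d) < 1" using assms by (simp add: powr_less_one)
  have "(\<lambda>k. B * 2 powr (- (real K * d)) * (2 powr (- d)) ^ k)
      sums (B * 2 powr (- (real K * d)) * (1 / (1 - 2 powr (- d))))"
    using lt by (intro sums_mult geometric_sums) auto
  moreover have "2 powr (- (real (k + K) * d)) = 2 powr (- (real K * d)) * 2 powr (- (real k * d))" for k
    unfolding powr_add[symmetric] by (simp add: algebra_simps)
  ultimately have "(\<lambda>k. if k + K < K then 0 else B * 2 powr (- (real (k + K) * d)))
      sums (B * 2 powr (- (real K * d)) / (1 - 2 powr (- d)))"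
    by (simp add: pw mult.assoc)
  then have s: "(\<lambda>k. if k < K then 0 else B * 2 powr (- (real k * d)))
      sums (B * 2 powr (- (real K * d)) / (1 - 2 powr (- d)))"
    by (subst (asm) sums_zero_iff_shift) auto
  have "(\<Sum>k. if k < K then 0 else ennreal (B * 2 powr (- (real k * d))))
      = (\<Sum>k. ennreal (if k < K then 0 else B * 2 powr (- (real k * d))))"
    by (intro suminf_cong) simp
  also have "\<dots> = ennreal (B * 2 powr (- (real K * d)) / (1 - 2 powr (- d)))"
    using s assms by (intro suminf_ennreal_eq) auto
  finally show ?thesis .
qed

lemma sum_geometric_powr_le:
  fixes m :: real
  assumes "0 < m"
  shows "(\<Sum>k<K. 2 powr (real k * m)) \<le> 2 powr (real K * m) / (2 powr m - 1)"
proof -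
  have pw: "2 powr (real k * m) = (2 powr m) ^ k" for k
    by (simp add: powr_powr mult.commute flip: powr_realpow)
  have gt: "1 < 2 powr m" using assms by simp
  then have "(\<Sum>k<K. (2 powr m) ^ k) = ((2 powr m) ^ K - 1) / (2 powr m - 1)"
    using minus_divide_divide[of "1 - (2 powr m) ^ K" "1 - 2 powr m"] assms by (simp add: sum_gp_strict)
  also have "\<dots> \<le> (2 powr m) ^ K / (2 powr m - 1)"
    using gt by (intro divide_right_mono) auto
  finally show ?thesis unfolding pw .
qed

text \<open>The pointwise majorant of the convolution, when \<open>u\<close> is the modulus of the periodic extension of \<open>f\<close>.
  For the estimates, periodicity is encoded as a bound on the integrals of \<open>u\<^sup>p\<close> over sets of small
  diameter in arbitrary position.\<close>
definition majorant :: "(real ^ 'n \<Rightarrow> real) \<Rightarrow> (real ^ 'n \<Rightarrow> complex) \<Rightarrow> real ^ 'n \<Rightarrow> ennreal" where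
  "majorant u g x = (\<integral>\<^sup>+ y. ennreal (u (x - y) * norm (g y)) \<partial>lebesgue_on torus_cube)"

context
  fixes u :: "real ^ 'n \<Rightarrow> real" and g :: "real ^ 'n \<Rightarrow> complex" and T :: "(real ^ 'n) set set"
    and p' :: ereal and p \<alpha> \<gamma> A B N :: real
  assumes u[measurable]: "u \<in> borel_measurable borel" and u0: "\<And>x. 0 \<le> u x"
    and g: "g \<in> borel_measurable (lebesgue_on torus_cube)"
    and T: "dyadic_partition T"
    and p: "1 \<le> p" and p': "1 \<le> p'" "1 / ereal p + 1 / p' = 1"
    and A: "0 < A" and B: "0 < B" and N: "0 \<le> N"
    and uE: "\<And>E s. \<lbrakk>E \<in> sets borel; 0 < s; s \<le> 2; \<And>a b i. a \<in> E \<Longrightarrow> b \<in> E \<Longrightarrow> \<bar>a $ i - b $ i\<bar> \<le> s\<rbrakk> \<Longrightarrow>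
      (\<integral>\<^sup>+ x. ennreal (u x powr p) * indicator E x \<partial>lborel) \<le> ennreal (N * (A * s powr \<gamma>) powr p)"
    and gB: "\<And>k. (\<Sum>Q\<in>T \<inter> dyadic_level k. Lp_norm p' (lebesgue_on Q) g) \<le> ennreal (B * 2 powr (real k * \<alpha>))"
begin

definition local_energy :: "(real ^ 'n) set \<Rightarrow> real ^ 'n \<Rightarrow> ennreal" where
  "local_energy Q x = (\<integral>\<^sup>+ y. ennreal (u (x - y) powr p) * indicator Q y \<partial>lborel)"

definition level_part :: "nat \<Rightarrow> real ^ 'n \<Rightarrow> ennreal" where
  "level_part k x = (\<Sum>Q\<in>T \<inter> dyadic_level k. \<integral>\<^sup>+ y. ennreal (u (x - y) * norm (g y)) \<partial>lebesgue_on Q)"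

text \<open>The weight makes \<open>level_part k x \<le> t w + t\<^bsup>1-p\<^esup> level_energy k x\<close> with \<open>w = B 2\<^bsup>-k\<delta>\<^esup>\<close> and one \<open>t\<close> for all
  levels \<open>k\<close>; the integral of \<open>level_energy k\<close> over a cube is controlled by the same \<open>w\<close>.\<close>
definition level_energy :: "nat \<Rightarrow> real ^ 'n \<Rightarrow> ennreal" where
  "level_energy k x = ennreal (2 powr (real k * real CARD('n) * (1 - 1 / p))) *
     (\<Sum>Q\<in>T \<inter> dyadic_level k. Lp_norm p' (lebesgue_on Q) g * local_energy Q x)"

lemma u_reflect_measurable: "(\<lambda>y. u (x - y)) \<in> borel_measurable (lebesgue_on S)"
proof -
  have "(\<lambda>y. u (x - y)) \<in> borel_measurable lborel" by simp
  then show ?thesis by (intro measurable_restrict_space1 measurable_completion)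
qed

lemma majorant_le_level_parts: "majorant u g x \<le> (\<Sum>k. level_part k x)"
  unfolding majorant_def level_part_def
  by (intro nn_integral_dyadic_partition_le T)
     (intro measurable_compose[OF _ measurable_ennreal] borel_measurable_times
        u_reflect_measurable measurable_compose[OF g borel_measurable_norm])

lemma cube_part_le:
  assumes Q: "Q \<in> dyadic_level k" and s: "0 < s"
  shows "(\<integral>\<^sup>+ y. ennreal (u (x - y) * norm (g y)) \<partial>lebesgue_on Q)
    \<le> Lp_norm p' (lebesgue_on Q) g * (ennreal s + ennreal (s powr (1 - p)) * local_energy Q x)"
proof -
  have "g \<in> borel_measurable (lebesgue_on Q)"
    using g dyadic_level_subset[OF Q] by (rule measurable_restrict_mono)
  then show ?thesis
    using nn_integral_mult_le_Lp_norm[OF u_reflect_measurable _ u0 p p' s, of g Q x]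
    by (simp add: local_energy_def nn_integral_lebesgue_on[OF dyadic_level_borel[OF Q]])
qed

lemma local_energy_le:
  assumes Q: "Q \<in> dyadic_level k"
  shows "local_energy Q x \<le> ennreal (N * (A * 2 powr (- (real k * \<gamma>))) powr p)"
proof -
  have [measurable]: "Q \<in> sets borel" by (rule dyadic_level_borel[OF Q])
  have s: "1 / 2 ^ k \<le> (2::real)"
    by (rule order_trans[of _ 1]) (auto simp: divide_le_eq)
  have "local_energy Q x = (\<integral>\<^sup>+ y. ennreal (u (x - y) powr p) * indicator {z. x - z \<in> Q} (x - y) \<partial>lborel)"
    by (simp add: local_energy_def indicator_def)
  also have "\<dots> = (\<integral>\<^sup>+ z. ennreal (u z powr p) * indicator {z. x - z \<in> Q} z \<partial>lborel)"
    by (rule nn_integral_lborel_reflect) measurable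
  also have "\<dots> \<le> ennreal (N * (A * (1 / 2 ^ k) powr \<gamma>) powr p)"
  proof (rule uE)
    show "\<bar>a $ i - b $ i\<bar> \<le> 1 / 2 ^ k" if "a \<in> {z. x - z \<in> Q}" "b \<in> {z. x - z \<in> Q}" for a b i
      using dyadic_level_diameter[OF Q, of "x - b" "x - a" i] that by simp
  qed (use s in auto)
  also have "(1 / 2 ^ k) powr \<gamma> = 2 powr (- (real k * \<gamma>))"
    by (simp add: powr_divide powr_minus_divide powr_powr flip: powr_realpow)
  finally show ?thesis .
qed

text \<open>The parameter of Hoelder's inequality is, up to a constant, the uniform bound on the \<open>L\<^sub>p\<close> norms of \<open>u\<close> over cubes of this
  level, so that the two summands are of the same size.\<close>
lemma level_part_le_coarse: "level_part k x \<le> ennreal ((1 + N) * A * B * 2 powr (real k * (\<alpha> - \<gamma>)))"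
proof -
  define s where "s = A * 2 powr (- (real k * \<gamma>))"
  have s: "0 < s" using A by (simp add: s_def)
  have "level_part k x \<le> (\<Sum>Q\<in>T \<inter> dyadic_level k. Lp_norm p' (lebesgue_on Q) g * ennreal ((1 + N) * s))"
    unfolding level_part_def
  proof (rule sum_mono)
    fix Q assume "Q \<in> T \<inter> dyadic_level k"
    then have Q: "Q \<in> dyadic_level k" by simp
    have "ennreal s + ennreal (s powr (1 - p)) * local_energy Q x
        \<le> ennreal s + ennreal (s powr (1 - p)) * ennreal (N * s powr p)"
      unfolding s_def by (intro add_left_mono mult_left_mono local_energy_le[OF Q]) simp
    also have "\<dots> = ennreal (s + N * (s powr (1 - p) * s powr p))"
      using s N by (simp add: mult_ac flip: ennreal_mult ennreal_plus)
    also have "s powr (1 - p) * s powr p = s" using s by (simp flip: powr_add)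
    finally show "(\<integral>\<^sup>+ y. ennreal (u (x - y) * norm (g y)) \<partial>lebesgue_on Q)
        \<le> Lp_norm p' (lebesgue_on Q) g * ennreal ((1 + N) * s)"
      by (intro order_trans[OF cube_part_le[OF Q s]] mult_left_mono) (auto simp: algebra_simps)
  qed
  also have "\<dots> \<le> ennreal (B * 2 powr (real k * \<alpha>)) * ennreal ((1 + N) * s)"
    unfolding sum_distrib_right[symmetric] by (intro mult_right_mono gB) simp
  also have "\<dots> = ennreal (B * 2 powr (real k * \<alpha>) * ((1 + N) * s))"
    using B N s by (intro ennreal_mult[symmetric]) auto
  also have "B * 2 powr (real k * \<alpha>) * ((1 + N) * s) = (1 + N) * A * B * 2 powr (real k * (\<alpha> - \<gamma>))"
    by (simp add: s_def right_diff_distrib powr_diff powr_minus_divide)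
  finally show ?thesis .
qed

text \<open>Here the parameter is \<open>t\<close> times \<open>\<bar>Q\<bar>\<^bsup>1/p\<^esup>\<close>, so that \<open>t\<close> is measured against the \<open>p\<close>-th power mean of \<open>u\<close>
  over \<open>x - Q\<close>. Unlike the norm, this mean is not tied to the size of \<open>Q\<close>, and one \<open>t\<close> can serve all levels.\<close>
lemma level_part_le_fine:
  assumes t: "0 < t"
  shows "level_part k x \<le> ennreal t * ennreal (B * 2 powr (- (real k * (real CARD('n) / p - \<alpha>))))
    + ennreal (t powr (1 - p)) * level_energy k x"
proof -
  define s where "s = t * 2 powr (- (real k * (real CARD('n) / p)))"
  have s: "0 < s" using t by (simp add: s_def)
  let ?b = "\<lambda>Q. Lp_norm p' (lebesgue_on Q) g"
  have "level_part k x \<le> (\<Sum>Q\<in>T \<inter> dyadic_level k. ?b Q * (ennreal s + ennreal (s powr (1 - p)) * local_energy Q x))"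
    unfolding level_part_def by (intro sum_mono cube_part_le[OF _ s]) auto
  also have "\<dots> = (\<Sum>Q\<in>T \<inter> dyadic_level k. ?b Q) * ennreal s
      + ennreal (s powr (1 - p)) * (\<Sum>Q\<in>T \<inter> dyadic_level k. ?b Q * local_energy Q x)"
    by (simp add: sum_distrib_left sum_distrib_right sum.distrib[symmetric] distrib_left mult_ac)
  also have "\<dots> \<le> ennreal (B * 2 powr (real k * \<alpha>)) * ennreal s
      + ennreal (s powr (1 - p)) * (\<Sum>Q\<in>T \<inter> dyadic_level k. ?b Q * local_energy Q x)"
    by (intro add_right_mono mult_right_mono gB) simp
  also have "ennreal (B * 2 powr (real k * \<alpha>)) * ennreal s
      = ennreal t * ennreal (B * 2 powr (- (real k * (real CARD('n) / p - \<alpha>))))"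
    using B t by (simp add: s_def right_diff_distrib powr_diff powr_minus_divide flip: ennreal_mult)
  also have "s powr (1 - p) = t powr (1 - p) * 2 powr (real k * real CARD('n) * (1 - 1 / p))"
  proof -
    have "- (real k * (real CARD('n) / p)) * (1 - p) = real k * real CARD('n) * (1 - 1 / p)"
      using p by (simp add: field_simps)
    then show ?thesis using t by (simp add: s_def powr_mult powr_powr)
  qed
  finally show ?thesis
    using t by (simp add: level_energy_def ennreal_mult mult.assoc)
qed

lemma majorant_le_splitting:
  fixes K :: nat
  defines "\<delta> \<equiv> real CARD('n) / p - \<alpha>"
  assumes t: "0 < t" and \<delta>: "0 < \<delta>" and \<mu>: "0 < \<alpha> - \<gamma>"
  shows "majorant u g x \<le> ennreal ((1 + N) * A * B * 2 powr (real K * (\<alpha> - \<gamma>)) / (2 powr (\<alpha> - \<gamma>) - 1))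
    + ennreal (t * (B * 2 powr (- (real K * \<delta>)) / (1 - 2 powr (- \<delta>))))
    + ennreal (t powr (1 - p)) * (\<Sum>k. if k < K then 0 else level_energy k x)"
proof -
  let ?c = "\<lambda>k. if k < K then ennreal ((1 + N) * A * B * 2 powr (real k * (\<alpha> - \<gamma>))) else 0"
  let ?w = "\<lambda>k. if k < K then 0 else ennreal (B * 2 powr (- (real k * \<delta>)))"
  let ?z = "\<lambda>k. if k < K then 0 else level_energy k x"
  have "level_part k x \<le> ?c k + (ennreal t * ?w k + ennreal (t powr (1 - p)) * ?z k)" for k
    using level_part_le_coarse level_part_le_fine[OF t] by (simp add: \<delta>_def)
  then have "majorant u g x \<le> (\<Sum>k. ?c k + (ennreal t * ?w k + ennreal (t powr (1 - p)) * ?z k))"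
    by (intro order_trans[OF majorant_le_level_parts] suminf_le) auto
  also have "\<dots> = (\<Sum>k. ?c k) + (ennreal t * (\<Sum>k. ?w k) + ennreal (t powr (1 - p)) * (\<Sum>k. ?z k))"
    by (simp add: suminf_add[symmetric])
  also have "(\<Sum>k. ?c k) = (\<Sum>k<K. ?c k)"
    by (rule suminf_finite) auto
  also have "\<dots> = ennreal ((1 + N) * A * B * (\<Sum>k<K. 2 powr (real k * (\<alpha> - \<gamma>))))"
    using A B N by (simp add: sum_distrib_left)
  also have "\<dots> \<le> ennreal ((1 + N) * A * B * (2 powr (real K * (\<alpha> - \<gamma>)) / (2 powr (\<alpha> - \<gamma>) - 1)))"
    using A B N by (intro ennreal_leI mult_left_mono sum_geometric_powr_le[OF \<mu>]) auto
  also have "ennreal t * (\<Sum>k. ?w k) = ennreal (t * (B * 2 powr (- (real K * \<delta>)) / (1 - 2 powr (- \<delta>))))"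
  proof -
    have "2 powr (- \<delta>) < 1" using \<delta> by (simp add: powr_less_one)
    then have "0 \<le> B * 2 powr (- (real K * \<delta>)) / (1 - 2 powr (- \<delta>))" using B by simp
    then show ?thesis using t B \<delta> by (subst suminf_geometric_tail) (auto simp only: ennreal_mult)
  qed
  finally show ?thesis by (simp add: add.assoc add_right_mono)
qed

lemma local_energy_measurable [measurable]:
  assumes [measurable]: "Q \<in> sets borel"
  shows "local_energy Q \<in> borel_measurable borel"
proof -
  have "(\<lambda>(x, y). ennreal (u (x - y) powr p) * indicator Q y) \<in> borel_measurable (borel \<Otimes>\<^sub>M lborel)"
    by measurable
  then show ?thesis
    unfolding local_energy_def[abs_def] by (intro lborel.borel_measurable_nn_integral) 
qed

lemma level_energy_measurable [measurable]: "level_energy k \<in> borel_measurable borel"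
  unfolding level_energy_def[abs_def]
  by (intro borel_measurable_times_ennreal borel_measurable_sum borel_measurable_const local_energy_measurable)
     (auto intro: dyadic_level_borel)

text \<open>Tonelli: for fixed \<open>y\<close>, the inner integral runs over the translate \<open>E - y\<close>, whose diameter is that of
  \<open>E\<close>, and the outer integral contributes the volume of \<open>Q\<close>.\<close>
lemma nn_integral_local_energy_le:
  assumes Q: "Q \<in> dyadic_level k" and [measurable]: "E \<in> sets borel" and s: "0 < s" "s \<le> 2"
    and E: "\<And>a b i. a \<in> E \<Longrightarrow> b \<in> E \<Longrightarrow> \<bar>a $ i - b $ i\<bar> \<le> s"
  shows "(\<integral>\<^sup>+ x. local_energy Q x * indicator E x \<partial>lborel)
    \<le> ennreal (N * (A * s powr \<gamma>) powr p) * ennreal (2 powr (- (real k * real CARD('n))))"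
proof -
  have [measurable]: "Q \<in> sets borel" by (rule dyadic_level_borel[OF Q])
  have inner: "(\<integral>\<^sup>+ x. ennreal (u (x - y) powr p) * indicator E x \<partial>lborel) \<le> ennreal (N * (A * s powr \<gamma>) powr p)" for y
  proof -
    have "(\<integral>\<^sup>+ x. ennreal (u (x - y) powr p) * indicator E x \<partial>lborel)
        = (\<integral>\<^sup>+ x. ennreal (u (x - y) powr p) * indicator {z. z + y \<in> E} (x - y) \<partial>lborel)"
      by (simp add: indicator_def)
    also have "\<dots> = (\<integral>\<^sup>+ z. ennreal (u z powr p) * indicator {z. z + y \<in> E} z \<partial>lborel)"
      by (rule nn_integral_lborel_translate) measurable
    also have "\<dots> \<le> ennreal (N * (A * s powr \<gamma>) powr p)"
      using s by (intro uE) (auto dest: E)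
    finally show ?thesis .
  qed
  have "(\<integral>\<^sup>+ x. local_energy Q x * indicator E x \<partial>lborel)
      = (\<integral>\<^sup>+ x. \<integral>\<^sup>+ y. ennreal (u (x - y) powr p) * indicator Q y * indicator E x \<partial>lborel \<partial>lborel)"
    by (simp add: local_energy_def nn_integral_multc)
  also have "\<dots> = (\<integral>\<^sup>+ y. \<integral>\<^sup>+ x. ennreal (u (x - y) powr p) * indicator Q y * indicator E x \<partial>lborel \<partial>lborel)"
    by (intro lborel_pair.Fubini') simp
  also have "\<dots> = (\<integral>\<^sup>+ y. indicator Q y * (\<integral>\<^sup>+ x. ennreal (u (x - y) powr p) * indicator E x \<partial>lborel) \<partial>lborel)"
    by (intro nn_integral_cong, subst nn_integral_cmult[symmetric]) (auto simp: mult_ac)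
  also have "\<dots> \<le> (\<integral>\<^sup>+ y. indicator Q y * ennreal (N * (A * s powr \<gamma>) powr p) \<partial>lborel)"
    by (intro nn_integral_mono mult_left_mono inner) simp
  also have "\<dots> = ennreal (N * (A * s powr \<gamma>) powr p) * emeasure lborel Q"
    by (simp add: nn_integral_multc mult.commute)
  also have "\<dots> \<le> ennreal (N * (A * s powr \<gamma>) powr p) * ennreal (1 / 2 ^ (k * CARD('n)))"
    by (intro mult_left_mono emeasure_dyadic_level_le[OF Q]) simp
  also have "1 / 2 ^ (k * CARD('n)) = (2::real) powr (- (real k * real CARD('n)))"
    by (simp add: powr_minus_divide flip: powr_realpow)
  finally show ?thesis .
qed

lemma nn_integral_level_energy_le:
  assumes [measurable]: "E \<in> sets borel" and s: "0 < s" "s \<le> 2"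
    and E: "\<And>a b i. a \<in> E \<Longrightarrow> b \<in> E \<Longrightarrow> \<bar>a $ i - b $ i\<bar> \<le> s"
  shows "(\<integral>\<^sup>+ x. level_energy k x * indicator E x \<partial>lborel)
    \<le> ennreal (N * (A * s powr \<gamma>) powr p) * ennreal (B * 2 powr (- (real k * (real CARD('n) / p - \<alpha>))))"
proof -
  let ?e = "ennreal (2 powr (real k * real CARD('n) * (1 - 1 / p)))"
  let ?v = "ennreal (2 powr (- (real k * real CARD('n))))"
  let ?D = "ennreal (N * (A * s powr \<gamma>) powr p)"
  let ?b = "\<lambda>Q. Lp_norm p' (lebesgue_on Q) g"
  have [measurable]: "Q \<in> sets borel" if "Q \<in> T \<inter> dyadic_level k" for Q
    using that dyadic_level_borel by auto
  have "(\<integral>\<^sup>+ x. level_energy k x * indicator E x \<partial>lborel)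
      = (\<integral>\<^sup>+ x. (\<Sum>Q\<in>T \<inter> dyadic_level k. ?e * ?b Q * (local_energy Q x * indicator E x)) \<partial>lborel)"
    by (simp add: level_energy_def sum_distrib_left sum_distrib_right mult_ac)
  also have "\<dots> = (\<Sum>Q\<in>T \<inter> dyadic_level k. ?e * ?b Q * (\<integral>\<^sup>+ x. local_energy Q x * indicator E x \<partial>lborel))"
    by (subst nn_integral_sum) (auto simp: nn_integral_cmult)
  also have "\<dots> \<le> (\<Sum>Q\<in>T \<inter> dyadic_level k. ?e * ?b Q * (?D * ?v))"
    by (intro sum_mono mult_left_mono nn_integral_local_energy_le[of _ k]) (use s E in auto)
  also have "\<dots> = ?D * (?e * ?v * (\<Sum>Q\<in>T \<inter> dyadic_level k. ?b Q))"
  proof -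
    have "?e * ?b Q * (?D * ?v) = ?D * (?e * ?v) * ?b Q" for Q by (simp only: mult_ac)
    then show ?thesis by (simp only: sum_distrib_left[symmetric] mult.assoc)
  qed
  also have "\<dots> \<le> ?D * (?e * ?v * ennreal (B * 2 powr (real k * \<alpha>)))"
    by (intro mult_left_mono gB) simp_all
  also have "?e * ?v * ennreal (B * 2 powr (real k * \<alpha>)) = ennreal (B * 2 powr (- (real k * (real CARD('n) / p - \<alpha>))))"
  proof -
    have "2 powr (real k * real CARD('n) * (1 - 1 / p)) * 2 powr (- (real k * real CARD('n))) * 2 powr (real k * \<alpha>)
        = 2 powr (- (real k * (real CARD('n) / p - \<alpha>)))"
      unfolding powr_add[symmetric] by (simp add: algebra_simps)
    then show ?thesis using B by (simp add: mult_ac flip: ennreal_mult)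
  qed
  finally show ?thesis .
qed

text \<open>The scale \<open>K\<close> of the cube is also where coarse levels are separated from fine ones. Up to a
  constant, \<open>t0 = A R\<^bsup>\<gamma>-n/p\<^esup>\<close> is the \<open>p\<close>-th power mean that the hypothesis on \<open>u\<close> allows on a cube of
  radius \<open>R\<close>, and the product \<open>W t0\<close> is a multiple of \<open>A B R\<^bsup>\<gamma>-\<alpha>\<^esup>\<close>, which is the size of the sum over the
  coarse levels. This is why both parts give the same power of \<open>R\<close>.\<close>
lemma nn_integral_majorant_powr_le:
  fixes K :: nat and q :: real
  defines "\<delta> \<equiv> real CARD('n) / p - \<alpha>"
  assumes q: "0 < q" "q \<le> p" and \<delta>: "0 < \<delta>" and \<mu>: "0 < \<alpha> - \<gamma>"
  shows "(\<integral>\<^sup>+ x. ennpowr (majorant u g x) q * indicator (centred_cube (1 / 2 ^ K) x0) x \<partial>lborel)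
    \<le> ennreal ((((1 + N) * (1 - 2 powr (- \<delta>)) / (2 powr (\<alpha> - \<gamma>) - 1) + 2) / (1 - 2 powr (- \<delta>))) powr q
         * (2 ^ CARD('n) + N * 2 powr (\<gamma> * p)) * (A * B) powr q * 2 powr (real K * ((\<alpha> - \<gamma>) * q - real CARD('n))))"
proof -
  define R where "R = (2 powr (- real K) :: real)"
  have R: "1 / 2 ^ K = R" "0 < R" "R \<le> 1"
    by (auto simp: R_def powr_minus_divide powr_realpow divide_le_eq)
  define E where "E = centred_cube R x0"
  have [measurable]: "E \<in> sets borel" unfolding E_def by simp
  define n where "n = real CARD('n)"
  \<comment> \<open>The two geometric series, over fine and over coarse levels, have \<open>d\<close> and \<open>m\<close> as denominators.\<close>
  define d where "d = 1 - 2 powr (- \<delta>)"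
  have d: "0 < d" using \<delta> by (simp add: d_def powr_less_one)
  define m where "m = 2 powr (\<alpha> - \<gamma>) - 1"
  have m: "0 < m" using \<mu> by (simp add: m_def)
  define W where "W = B * 2 powr (- (real K * \<delta>)) / d"
  define t0 where "t0 = A * 2 powr (real K * (n / p - \<gamma>))"
  define C0 where "C0 = (1 + N) * d / m"
  have pos: "0 < W" "0 < t0" "0 \<le> C0" using A B N d m by (auto simp: W_def t0_def C0_def)
  have Wt0: "W * t0 = A * B * 2 powr (real K * (\<alpha> - \<gamma>)) / d"
  proof -
    have "2 powr (- (real K * \<delta>)) * 2 powr (real K * (n / p - \<gamma>)) = 2 powr (real K * (\<alpha> - \<gamma>))"
      unfolding powr_add[symmetric] by (simp add: \<delta>_def n_def algebra_simps)
    then show ?thesis by (simp add: W_def t0_def mult_ac)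
  qed
  define Z where "Z x = (\<Sum>k. if k < K then 0 else level_energy k x)" for x
  have [measurable]: "Z \<in> borel_measurable borel"
    unfolding Z_def by measurable
  define D where "D = N * (A * (2 * R) powr \<gamma>) powr p"
  have "0 \<le> D" using N by (simp add: D_def)
  have diamE: "\<bar>a $ i - b $ i\<bar> \<le> 2 * R" if "a \<in> E" "b \<in> E" for a b i
    using that[unfolded E_def centred_cube_def mem_Collect_eq, THEN spec[of _ i]] by linarith
  have ZE: "(\<integral>\<^sup>+ x. Z x * indicator E x \<partial>lborel) \<le> ennreal (D * W)"
  proof -
    have "(\<integral>\<^sup>+ x. Z x * indicator E x \<partial>lborel)
        = (\<integral>\<^sup>+ x. (\<Sum>k. (if k < K then 0 else level_energy k x * indicator E x)) \<partial>lborel)"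
      unfolding Z_def by (intro nn_integral_cong) (simp split: split_indicator cong: if_cong)
    also have "\<dots> = (\<Sum>k. \<integral>\<^sup>+ x. (if k < K then 0 else level_energy k x * indicator E x) \<partial>lborel)"
      by (intro nn_integral_suminf) simp
    also have "\<dots> \<le> (\<Sum>k. ennreal D * (if k < K then 0 else ennreal (B * 2 powr (- (real k * \<delta>)))))"
      unfolding D_def \<delta>_def using R(2,3) diamE
      by (intro suminf_le) (auto intro!: nn_integral_level_energy_le)
    also have "\<dots> = ennreal D * ennreal W"
      unfolding W_def d_def using B \<delta> by (simp add: suminf_geometric_tail)
    finally show ?thesis using \<open>0 \<le> D\<close> pos by (simp add: ennreal_mult)
  qed
  have point: "ennpowr (majorant u g x) q \<le> ennreal (((C0 + 2) * W) powr q)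
      * (ennreal (t0 powr q) + ennreal (t0 powr (q - p) / W) * Z x)" for x
  proof (rule ennpowr_le_of_splitting)
    fix t :: real assume t: "0 < t"
    have "C0 * W * t0 = (1 + N) * A * B * 2 powr (real K * (\<alpha> - \<gamma>)) / m"
      unfolding mult.assoc Wt0 using d by (simp add: C0_def)
    then show "majorant u g x \<le> ennreal (C0 * W * t0) + ennreal (t * W) + ennreal (t powr (1 - p)) * Z x"
      using majorant_le_splitting[OF t, of x K] \<delta> \<mu> by (simp add: \<delta>_def W_def d_def m_def Z_def)
  qed (use pos q p in auto)
  have t0D: "t0 powr (- p) * D = N * 2 powr (\<gamma> * p) * 2 powr (- (real K * n))"
  proof -
    have "t0 powr (- p) * (A * (2 * R) powr \<gamma>) powr p
        = (A powr (- p) * A powr p) * (2 powr (- (real K * (n / p - \<gamma>) * p)) * (2 powr (\<gamma> * p) * 2 powr (- (real K * \<gamma> * p))))"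
      using A by (simp add: t0_def R_def powr_mult powr_powr mult_ac)
    also have "A powr (- p) * A powr p = 1" using A by (simp flip: powr_add)
    also have "2 powr (- (real K * (n / p - \<gamma>) * p)) * (2 powr (\<gamma> * p) * 2 powr (- (real K * \<gamma> * p)))
        = (2 powr (\<gamma> * p) * 2 powr (- (real K * n)) :: real)"
      unfolding powr_add[symmetric] using p by (simp add: field_simps)
    finally show ?thesis by (simp add: D_def mult_ac)
  qed
  have emE: "emeasure lborel E = ennreal (2 ^ CARD('n) * 2 powr (- (real K * n)))"
  proof -
    have "(2 * R) ^ CARD('n) = 2 ^ CARD('n) * 2 powr (- (real K * n))"
      by (simp add: R_def n_def power_mult_distrib powr_powr flip: powr_realpow)
    then show ?thesis using R unfolding E_def by (subst emeasure_centred_cube) auto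
  qed
  define c where "c = ((C0 + 2) * W) powr q"
  have ct0: "((C0 + 2) * (W * t0)) powr q = c * t0 powr q"
    using pos by (simp add: c_def powr_mult mult.assoc[symmetric])
  have "(\<integral>\<^sup>+ x. ennpowr (majorant u g x) q * indicator E x \<partial>lborel)
      \<le> (\<integral>\<^sup>+ x. ennreal c * (ennreal (t0 powr q) * indicator E x
            + ennreal (t0 powr (q - p) / W) * (Z x * indicator E x)) \<partial>lborel)"
    using point by (intro nn_integral_mono) (auto simp: c_def split: split_indicator)
  also have "\<dots> = ennreal c * (ennreal (t0 powr q) * emeasure lborel E
      + ennreal (t0 powr (q - p) / W) * (\<integral>\<^sup>+ x. Z x * indicator E x \<partial>lborel))"
    by (simp add: nn_integral_cmult nn_integral_add)
  also have "\<dots> \<le> ennreal c * (ennreal (t0 powr q) * ennreal (2 ^ CARD('n) * 2 powr (- (real K * n)))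
      + ennreal (t0 powr (q - p) / W) * ennreal (D * W))"
    unfolding emE by (intro mult_left_mono add_left_mono ZE) auto
  also have "\<dots> = ennreal (c * (t0 powr q * (2 ^ CARD('n) * 2 powr (- (real K * n))) + t0 powr (q - p) * D))"
    using pos \<open>0 \<le> D\<close> by (simp add: c_def flip: ennreal_mult ennreal_plus)
  also have "t0 powr (q - p) * D = t0 powr q * (t0 powr (- p) * D)"
    using pos by (simp add: powr_add[symmetric] mult.assoc[symmetric])
  also have "c * (t0 powr q * (2 ^ CARD('n) * 2 powr (- (real K * n))) + t0 powr q * (t0 powr (- p) * D))
      = ((C0 + 2) * (W * t0)) powr q * (2 ^ CARD('n) + N * 2 powr (\<gamma> * p)) * 2 powr (- (real K * n))"
    unfolding t0D ct0 by (simp add: algebra_simps)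
  also have "((C0 + 2) * (W * t0)) powr q = ((C0 + 2) / d) powr q * (A * B) powr q * 2 powr (real K * (\<alpha> - \<gamma>) * q)"
    unfolding Wt0 using pos A B d by (simp add: powr_mult powr_divide powr_powr)
  also have "((C0 + 2) / d) powr q * (A * B) powr q * 2 powr (real K * (\<alpha> - \<gamma>) * q)
        * (2 ^ CARD('n) + N * 2 powr (\<gamma> * p)) * 2 powr (- (real K * n))
      = ((C0 + 2) / d) powr q * (2 ^ CARD('n) + N * 2 powr (\<gamma> * p)) * (A * B) powr q
        * (2 powr (real K * (\<alpha> - \<gamma>) * q) * 2 powr (- (real K * n)))"
    by (simp only: mult_ac)
  also have "2 powr (real K * (\<alpha> - \<gamma>) * q) * 2 powr (- (real K * n)) = (2 powr (real K * ((\<alpha> - \<gamma>) * q - n)) :: real)"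
    unfolding powr_add[symmetric] by (simp add: algebra_simps)
  finally show ?thesis
    unfolding E_def R(1) by (simp add: C0_def d_def m_def n_def)
qed

end

section \<open>Morrey norms from dyadic scales\<close>

lemma ennpowr_le_imp_le:
  assumes "ennpowr x (1 / r) \<le> ennreal a" "0 < r" "0 \<le> a"
  shows "x \<le> ennreal (a powr r)"
proof (cases x)
  case (real v)
  then have "v powr (1 / r) \<le> a"
    using assms by (simp add: ennpowr_ennreal)
  then have "(v powr (1 / r)) powr r \<le> a powr r"
    using assms by (intro powr_mono2) auto
  then show ?thesis using real assms by (simp add: powr_powr ennreal_leI)
qed (use assms in \<open>simp add: ennpowr_def top_unique\<close>)

lemma ennpowr_measurable [measurable]:
  assumes [measurable]: "h \<in> borel_measurable M"
  shows "(\<lambda>x. ennpowr (h x) r) \<in> borel_measurable M"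
  unfolding ennpowr_def by measurable

lemma AE_lebesgue_onI:
  "S \<in> sets borel \<Longrightarrow> AE x in lborel. x \<in> S \<longrightarrow> P x \<Longrightarrow> AE x in lebesgue_on S. P x"
  by (subst AE_restrict_space_iff) (auto intro: AE_completion)

lemma AE_measurable_lebesgue_on:
  fixes f f0 :: "'a::euclidean_space \<Rightarrow> complex"
  assumes S: "S \<in> sets borel" and f0: "f0 \<in> borel_measurable (lebesgue_on S)"
    and eq: "AE x in lborel. x \<in> S \<longrightarrow> f x = f0 x"
  shows "f \<in> borel_measurable (lebesgue_on S)"
proof -
  have "(\<lambda>x. if x \<in> S then f0 x else 0) \<in> borel_measurable lebesgue"
    using f0 S by (intro borel_measurable_if_I) auto
  moreover have "AE x in lebesgue. (if x \<in> S then f0 x else 0) = (if x \<in> S then f x else 0)"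
    using AE_completion[OF eq] by eventually_elim auto
  ultimately have "(\<lambda>x. if x \<in> S then f x else 0) \<in> borel_measurable lebesgue"
    by (rule borel_measurable_AE)
  then show ?thesis by (rule borel_measurable_if_D)
qed

lemma nn_integral_powr_le_of_morrey_norm_le:
  fixes f :: "real ^ 'n \<Rightarrow> complex"
  assumes A: "morrey_norm (ereal p) \<gamma> f \<le> ennreal A" "0 \<le> A" and p: "0 < p"
    and z: "z \<in> torus_cube" and s: "0 < s"
  shows "(\<integral>\<^sup>+ w. ennreal (norm (f w) powr p) * indicator (centred_cube s z \<inter> torus_cube) w \<partial>lborel)
    \<le> ennreal ((A * s powr \<gamma>) powr p)"
proof -
  let ?S = "centred_cube s z \<inter> torus_cube"
  let ?L = "Lp_norm (ereal p) (lebesgue_on ?S) f"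
  have "ennreal (s powr (- \<gamma>)) * ?L \<le> morrey_norm (ereal p) \<gamma> f"
    unfolding morrey_norm_def using z s by (intro SUP_upper2[of z] SUP_upper2[of s]) auto
  also note A(1)
  finally have "ennreal (s powr \<gamma>) * (ennreal (s powr (- \<gamma>)) * ?L) \<le> ennreal (s powr \<gamma>) * ennreal A"
    by (intro mult_left_mono) auto
  also have "ennreal (s powr \<gamma>) * (ennreal (s powr (- \<gamma>)) * ?L) = ?L"
    using s by (simp add: mult.assoc[symmetric] powr_add[symmetric] flip: ennreal_mult)
  finally have "?L \<le> ennreal (A * s powr \<gamma>)"
    using A s by (simp add: mult.commute flip: ennreal_mult)
  then show ?thesis
    using p A s unfolding Lp_norm_def
    by (simp add: nn_integral_lebesgue_on ennpowr_le_imp_le)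
qed

lemma dyadic_radius:
  fixes r :: real
  assumes "0 < r"
  obtains K :: nat where "1 / 2 ^ Suc K \<le> r" "r \<le> 1 / 2 ^ K \<or> K = 0"
proof -
  define P where "P n \<longleftrightarrow> (1 / 2 :: real) ^ n \<le> r" for n
  obtain n where "(1 / 2) ^ n < r"
    using real_arch_pow_inv[OF assms, of "1 / 2"] by auto
  then have n: "P n" by (simp add: P_def)
  show ?thesis
  proof (cases "P 0")
    case True
    then have "1 / 2 ^ Suc 0 \<le> r" by (simp add: P_def)
    then show ?thesis using that[of 0] by blast
  next
    case False
    then obtain K where K: "P (Suc K)" "\<not> P K"
      using ex_least_nat_less[OF n False] by auto
    then show ?thesis using that[of K] by (auto simp: P_def power_divide)
  qed
qed

lemma Lp_norm_le_of_nn_integral_le: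
  assumes "(\<integral>\<^sup>+ x. ennreal (norm (F x) powr q) \<partial>M) \<le> ennreal (a powr q)" "0 < q" "0 \<le> a"
  shows "Lp_norm (ereal q) M F \<le> ennreal a"
proof -
  have "Lp_norm (ereal q) M F \<le> ennpowr (ennreal (a powr q)) (1 / q)"
    unfolding Lp_norm_def using assms by (simp add: ennpowr_mono)
  also have "\<dots> = ennreal a" using assms by (simp add: ennpowr_ennreal powr_powr)
  finally show ?thesis .
qed

lemma torus_cube_subset_centred_cube:
  fixes x :: "real ^ 'n"
  assumes "x \<in> torus_cube" "1 \<le> r"
  shows "torus_cube \<subseteq> centred_cube r x"
proof
  fix y :: "real ^ 'n" assume y: "y \<in> torus_cube"
  have "\<bar>y $ i - x $ i\<bar> \<le> r" for i
  proof -
    have "0 \<le> x $ i" "x $ i \<le> 1" "0 \<le> y $ i" "y $ i \<le> 1"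
      using assms(1) y by (auto simp: torus_cube_def mem_box_cart)
    then show ?thesis using assms(2) by linarith
  qed
  then show "y \<in> centred_cube r x" by (simp add: centred_cube_def)
qed

text \<open>Radii may be rounded up to powers of two at the cost of the factor \<open>2\<^bsup>l\<^esup>\<close>, and radii above \<open>1\<close> add
  nothing: the cube of radius \<open>1\<close> around a point of the torus cube already contains the torus cube.\<close>
lemma morrey_norm_le_of_dyadic:
  fixes F :: "real ^ 'n \<Rightarrow> complex" and H :: "real ^ 'n \<Rightarrow> ennreal"
  assumes q: "0 < q" and l: "0 < l" and a: "0 \<le> a"
    and FH: "\<And>x. ennreal (norm (F x)) \<le> H x"
    and H: "\<And>x K. (\<integral>\<^sup>+ y. ennpowr (H y) q * indicator (centred_cube (1 / 2 ^ K) x) y \<partial>lborel)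
      \<le> ennreal ((a * 2 powr (- (real K * l))) powr q)"
  shows "morrey_norm (ereal q) l F \<le> ennreal (2 powr l * a)"
  unfolding morrey_norm_def
proof (intro SUP_least)
  fix x :: "real ^ 'n" and r :: real
  assume x: "x \<in> torus_cube" and "r \<in> {0<..}"
  then have r: "0 < r" by simp
  obtain K where K: "1 / 2 ^ Suc K \<le> r" "r \<le> 1 / 2 ^ K \<or> K = 0"
    using dyadic_radius[OF r] by blast
  let ?S = "centred_cube r x \<inter> torus_cube"
  have sub: "?S \<subseteq> centred_cube (1 / 2 ^ K) x"
    using K(2)
  proof
    assume "K = 0"
    then show ?thesis using torus_cube_subset_centred_cube[OF x, of 1] by auto
  next
    assume "r \<le> 1 / 2 ^ K"
    then show ?thesis unfolding centred_cube_def using order_trans by blast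
  qed
  have "(\<integral>\<^sup>+ y. ennreal (norm (F y) powr q) \<partial>lebesgue_on ?S)
      = (\<integral>\<^sup>+ y. ennpowr (ennreal (norm (F y))) q * indicator ?S y \<partial>lborel)"
    by (simp add: nn_integral_lebesgue_on ennpowr_ennreal)
  also have "\<dots> \<le> (\<integral>\<^sup>+ y. ennpowr (H y) q * indicator (centred_cube (1 / 2 ^ K) x) y \<partial>lborel)"
    using sub q FH by (intro nn_integral_mono mult_mono ennpowr_mono) (auto split: split_indicator)
  also note H
  finally have "Lp_norm (ereal q) (lebesgue_on ?S) F \<le> ennreal (a * 2 powr (- (real K * l)))"
    using q a by (intro Lp_norm_le_of_nn_integral_le) auto
  then have "ennreal (r powr (- l)) * Lp_norm (ereal q) (lebesgue_on ?S) F
      \<le> ennreal ((1 / 2 ^ Suc K) powr (- l)) * ennreal (a * 2 powr (- (real K * l)))"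
    using K(1) l by (intro mult_mono ennreal_leI powr_mono2') auto
  also have "\<dots> = ennreal (2 powr l * a)"
  proof -
    have "(1 / 2 ^ Suc K) powr (- l) * 2 powr (- (real K * l)) = 2 powr l"
    proof -
      have "(1 / 2 ^ Suc K :: real) = 2 powr (- (real K + 1))"
        by (subst powr_minus_divide) (simp add: powr_add powr_realpow)
      then show ?thesis
        by (simp only: powr_powr powr_add[symmetric]) (simp add: algebra_simps)
    qed
    then show ?thesis using a by (simp add: mult_ac flip: ennreal_mult)
  qed
  finally show "ennreal (r powr (- l)) * Lp_norm (ereal q) (lebesgue_on ?S) F \<le> ennreal (2 powr l * a)" .
qed

lemma lborel_imp_lebesgue_on_measurable:
  "h \<in> borel_measurable borel \<Longrightarrow> h \<in> borel_measurable (lebesgue_on S)"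
  by (intro measurable_restrict_space1 measurable_completion) simp

section \<open>Existence and measurability of the convolution\<close>

context
  fixes f g f0 g0 :: "real ^ 'n \<Rightarrow> complex" and u :: "real ^ 'n \<Rightarrow> real"
  assumes f0[measurable]: "f0 \<in> borel_measurable borel" and g0[measurable]: "g0 \<in> borel_measurable borel"
    and f: "AE x in lborel. x \<in> torus_cube \<longrightarrow> f x = f0 x"
    and g: "AE x in lborel. x \<in> torus_cube \<longrightarrow> g x = g0 x"
  defines "u \<equiv> \<lambda>x. norm (periodic_ext f0 x)"
begin

lemma AE_torus_conv_integrand_eq:
  "AE y in lborel. y \<in> torus_cube \<longrightarrow> torus_conv_integrand f g x y = torus_conv_integrand f0 g0 x y"
  using AE_periodic_ext_reflect_eq[OF f, of x] g
  by eventually_elim (simp add: torus_conv_integrand_def)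

lemma torus_conv_integrand_measurable0: "torus_conv_integrand f0 g0 x \<in> borel_measurable (lebesgue_on torus_cube)"
  unfolding torus_conv_integrand_def[abs_def] by (intro lborel_imp_lebesgue_on_measurable) measurable

lemma torus_conv_integrand_measurable: "torus_conv_integrand f g x \<in> borel_measurable (lebesgue_on torus_cube)"
  by (rule AE_measurable_lebesgue_on[OF _ torus_conv_integrand_measurable0 AE_torus_conv_integrand_eq]) simp

text \<open>Equality holds at every point, so the convolution is Borel measurable although \<open>f\<close> and \<open>g\<close> are only
  Lebesgue measurable.\<close>
lemma torus_conv_eq: "torus_conv f g x = torus_conv f0 g0 x"
  unfolding torus_conv_def
  by (intro integral_cong_AE torus_conv_integrand_measurable torus_conv_integrand_measurable0
      AE_lebesgue_onI AE_torus_conv_integrand_eq) simp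

lemma torus_conv_measurable: "torus_conv f g \<in> borel_measurable borel"
proof -
  have "torus_conv f g = (\<lambda>x. \<integral>y. indicator torus_cube y *\<^sub>R torus_conv_integrand f0 g0 x y \<partial>lborel)"
    unfolding torus_conv_eq[abs_def] torus_conv_def torus_conv_integrand_def[abs_def]
    by (simp add: integral_restrict_space integral_completion)
  moreover have "(\<lambda>(x, y). indicator torus_cube y *\<^sub>R torus_conv_integrand f0 g0 x y)
      \<in> borel_measurable (borel \<Otimes>\<^sub>M lborel)"
    unfolding torus_conv_integrand_def by measurable
  ultimately show ?thesis
    using lborel.borel_measurable_lebesgue_integral by fastforce
qed

lemma majorant_eq:
  "majorant u g x = (\<integral>\<^sup>+ y. ennreal (u (x - y) * norm (g0 y)) * indicator torus_cube y \<partial>lborel)"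
proof -
  have "majorant u g x = (\<integral>\<^sup>+ y. ennreal (u (x - y) * norm (g y)) * indicator torus_cube y \<partial>lborel)"
    by (simp add: majorant_def nn_integral_lebesgue_on)
  also have "\<dots> = (\<integral>\<^sup>+ y. ennreal (u (x - y) * norm (g0 y)) * indicator torus_cube y \<partial>lborel)"
    using g by (auto intro!: nn_integral_cong_AE elim!: eventually_mono split: split_indicator)
  finally show ?thesis .
qed

lemma majorant_measurable: "majorant u g \<in> borel_measurable borel"
proof -
  have "(\<lambda>(x, y). ennreal (u (x - y) * norm (g0 y)) * indicator torus_cube y) \<in> borel_measurable (borel \<Otimes>\<^sub>M lborel)"
    unfolding u_def by measurable
  then show ?thesis
    unfolding majorant_eq[abs_def] by (rule lborel.borel_measurable_nn_integral)
qed

lemma nn_integral_norm_torus_conv_integrand: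
  "(\<integral>\<^sup>+ y. ennreal (norm (torus_conv_integrand f g x y)) \<partial>lebesgue_on torus_cube) = majorant u g x"
proof -
  have "AE y in lborel. y \<in> torus_cube \<longrightarrow> norm (torus_conv_integrand f g x y) = u (x - y) * norm (g y)"
    using AE_periodic_ext_reflect_eq[OF f, of x]
    by eventually_elim (simp add: torus_conv_integrand_def u_def norm_mult)
  then have "AE y in lebesgue_on torus_cube. norm (torus_conv_integrand f g x y) = u (x - y) * norm (g y)"
    by (rule AE_lebesgue_onI[rotated]) simp
  then show ?thesis
    unfolding majorant_def by (auto intro!: nn_integral_cong_AE elim!: eventually_mono)
qed

lemma norm_torus_conv_le: "ennreal (norm (torus_conv f g x)) \<le> majorant u g x"
proof (cases "integrable (lebesgue_on torus_cube) (torus_conv_integrand f g x)")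
  case True
  then show ?thesis
    unfolding torus_conv_def nn_integral_norm_torus_conv_integrand[symmetric]
    by (rule integral_norm_bound_ennreal)
next
  case False
  then show ?thesis by (simp add: torus_conv_def not_integrable_integral_eq)
qed

text \<open>Finiteness of the estimate at the single scale \<open>1\<close> makes the majorant finite almost everywhere.\<close>
lemma torus_conv_exists_of_majorant:
  assumes "0 < q" and fin: "(\<integral>\<^sup>+ y. ennpowr (majorant u g y) q * indicator (centred_cube 1 0) y \<partial>lborel) < \<infinity>"
  shows "torus_conv_exists f g"
proof -
  note [measurable] = majorant_measurable
  have "AE x in lborel. ennpowr (majorant u g x) q * indicator (centred_cube 1 0) x \<noteq> \<infinity>"
    using fin by (intro nn_integral_PInf_AE) auto
  moreover have "torus_cube \<subseteq> centred_cube 1 (0 :: real ^ 'n)"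
    by (rule torus_cube_subset_centred_cube) (auto simp: torus_cube_def mem_box_cart)
  ultimately have "AE x in lborel. x \<in> torus_cube \<longrightarrow> majorant u g x < \<infinity>"
    by (auto elim!: eventually_mono simp: ennpowr_def subset_iff less_top split: split_indicator_asm if_splits)
  then have "AE x in lebesgue_on torus_cube. majorant u g x < \<infinity>"
    by (rule AE_lebesgue_onI[rotated]) simp
  then show ?thesis
    unfolding torus_conv_exists_def
    by eventually_elim
       (simp add: integrable_iff_bounded torus_conv_integrand_measurable nn_integral_norm_torus_conv_integrand)
qed

end

section \<open>The convolution inequality\<close>

text \<open>The norms of \<open>f\<close> and \<open>g\<close> are replaced by positive upper bounds, so that the heights and
  weights in the estimate of the majorant are nonzero also when a norm vanishes.\<close>
lemma convolution_morrey_estimate: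
  fixes p q l \<gamma> \<alpha> :: real and p' :: ereal
  assumes p: "1 \<le> p" and q: "0 < q" "q \<le> p" and p': "1 \<le> p'" "1 / ereal p + 1 / p' = 1"
    and l: "0 < l" "l < real CARD('n) / q"
    and \<alpha>: "\<alpha> = \<gamma> - l + real CARD('n) / q" "\<alpha> < real CARD('n) / p"
  shows "\<exists>c\<ge>0. \<forall>(T :: (real ^ 'n) set set) (f :: real ^ 'n \<Rightarrow> complex) g A B.
    dyadic_partition T \<longrightarrow> 0 < A \<longrightarrow> 0 < B \<longrightarrow>
    f \<in> borel_measurable (lebesgue_on torus_cube) \<longrightarrow> g \<in> borel_measurable (lebesgue_on torus_cube) \<longrightarrow>
    morrey_norm (ereal p) \<gamma> f \<le> ennreal A \<longrightarrow> local_morrey_norm p' \<infinity> (- \<alpha>) T g \<le> ennreal B \<longrightarrow>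
    torus_conv_exists f g \<and> torus_conv f g \<in> borel_measurable borel \<and>
    morrey_norm (ereal q) l (torus_conv f g) \<le> ennreal (c * A * B)"
proof -
  define n where "n = real CARD('n)"
  \<comment> \<open>The number of pieces when a set is cut along the integer lattice.\<close>
  define N :: real where "N = 5 ^ CARD('n)"
  define \<delta> where "\<delta> = n / p - \<alpha>"
  have \<delta>: "0 < \<delta>" using \<alpha> by (simp add: \<delta>_def n_def)
  have \<mu>: "0 < \<alpha> - \<gamma>" using \<alpha> l by simp
  have \<mu>q: "(\<alpha> - \<gamma>) * q - n = - (l * q)"
    using q unfolding \<alpha>(1) by (simp add: n_def field_simps)
  define C where "C = (((1 + N) * (1 - 2 powr (- \<delta>)) / (2 powr (\<alpha> - \<gamma>) - 1) + 2) / (1 - 2 powr (- \<delta>))) powr q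
      * (2 ^ CARD('n) + N * 2 powr (\<gamma> * p))"
  have C: "0 \<le> C" by (simp add: C_def N_def)
  show ?thesis
  proof (intro exI[of _ "2 powr l * C powr (1 / q)"] conjI allI impI)
    show "0 \<le> 2 powr l * C powr (1 / q)" by simp
    fix T :: "(real ^ 'n) set set" and f g :: "real ^ 'n \<Rightarrow> complex" and A B :: real
    assume T: "dyadic_partition T" and A: "0 < A" and B: "0 < B"
      and f: "f \<in> borel_measurable (lebesgue_on torus_cube)" and g: "g \<in> borel_measurable (lebesgue_on torus_cube)"
      and fA: "morrey_norm (ereal p) \<gamma> f \<le> ennreal A"
      and gB: "local_morrey_norm p' \<infinity> (- \<alpha>) T g \<le> ennreal B"
    obtain f0 where f0[measurable]: "f0 \<in> borel_measurable borel" and ff0: "AE x in lborel. x \<in> torus_cube \<longrightarrow> f x = f0 x"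
      using borel_representative_on[OF torus_cube_borel f] by blast
    obtain g0 where g0: "g0 \<in> borel_measurable borel" and gg0: "AE x in lborel. x \<in> torus_cube \<longrightarrow> g x = g0 x"
      using borel_representative_on[OF torus_cube_borel g] by blast
    define u :: "real ^ 'n \<Rightarrow> real" where "u = (\<lambda>x. norm (periodic_ext f0 x))"
    have u: "u \<in> borel_measurable borel" "\<And>x. 0 \<le> u x" by (simp_all add: u_def)
    have uE: "(\<integral>\<^sup>+ x. ennreal (u x powr p) * indicator E x \<partial>lborel) \<le> ennreal (N * (A * s powr \<gamma>) powr p)"
      if E: "E \<in> sets borel" and s: "0 < s" "s \<le> 2" and diam: "\<And>a b i. a \<in> E \<Longrightarrow> b \<in> E \<Longrightarrow> \<bar>a $ i - b $ i\<bar> \<le> s"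
      for E :: "(real ^ 'n) set" and s
    proof -
      have "(\<integral>\<^sup>+ w. ennreal (norm (f0 w) powr p) * indicator (centred_cube s z \<inter> torus_cube) w \<partial>lborel)
          \<le> ennreal ((A * s powr \<gamma>) powr p)" if z: "z \<in> torus_cube" for z
      proof -
        have "(\<integral>\<^sup>+ w. ennreal (norm (f0 w) powr p) * indicator (centred_cube s z \<inter> torus_cube) w \<partial>lborel)
            = (\<integral>\<^sup>+ w. ennreal (norm (f w) powr p) * indicator (centred_cube s z \<inter> torus_cube) w \<partial>lborel)"
          using ff0 by (auto intro!: nn_integral_cong_AE elim!: eventually_mono split: split_indicator)
        also have "\<dots> \<le> ennreal ((A * s powr \<gamma>) powr p)"
          using A p z s by (intro nn_integral_powr_le_of_morrey_norm_le[OF fA]) auto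
        finally show ?thesis .
      qed
      from nn_integral_periodic_ext_le[OF f0 E this diam s(2)]
      show ?thesis by (simp add: u_def N_def ennreal_mult)
    qed
    have gBk: "(\<Sum>Q\<in>T \<inter> dyadic_level k. Lp_norm p' (lebesgue_on Q) g) \<le> ennreal (B * 2 powr (real k * \<alpha>))" for k
    proof -
      let ?S = "\<Sum>Q\<in>T \<inter> dyadic_level k. Lp_norm p' (lebesgue_on Q) g"
      have "ennreal (2 powr (real k * - \<alpha>)) * ?S \<le> local_morrey_norm p' \<infinity> (- \<alpha>) T g"
        unfolding local_morrey_norm_def local_morrey_term_def by (auto intro: SUP_upper)
      also note gB
      finally have "ennreal (2 powr (real k * \<alpha>)) * (ennreal (2 powr (real k * - \<alpha>)) * ?S) \<le> ennreal (2 powr (real k * \<alpha>)) * ennreal B"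
        by (rule mult_left_mono) simp
      also have "ennreal (2 powr (real k * \<alpha>)) * (ennreal (2 powr (real k * - \<alpha>)) * ?S) = ?S"
        by (simp add: mult.assoc[symmetric] powr_add[symmetric] flip: ennreal_mult)
      finally show ?thesis using B by (simp add: mult.commute flip: ennreal_mult)
    qed
    have H: "(\<integral>\<^sup>+ y. ennpowr (majorant u g y) q * indicator (centred_cube (1 / 2 ^ K) x) y \<partial>lborel)
        \<le> ennreal ((C powr (1 / q) * A * B * 2 powr (- (real K * l))) powr q)" for K x
    proof -
      have "(\<integral>\<^sup>+ y. ennpowr (majorant u g y) q * indicator (centred_cube (1 / 2 ^ K) x) y \<partial>lborel)
          \<le> ennreal (C * (A * B) powr q * 2 powr (real K * ((\<alpha> - \<gamma>) * q - n)))"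
        unfolding C_def \<delta>_def n_def
        by (rule nn_integral_majorant_powr_le[OF u g T p p' A B _ uE gBk q _ \<mu>])
           (use \<delta> in \<open>auto simp: N_def \<delta>_def n_def\<close>)
      also have "C * (A * B) powr q * 2 powr (real K * ((\<alpha> - \<gamma>) * q - n))
          = (C powr (1 / q) * A * B * 2 powr (- (real K * l))) powr q"
        unfolding \<mu>q using A B C q by (simp add: powr_mult powr_powr mult_ac)
      finally show ?thesis .
    qed
    have "(\<integral>\<^sup>+ y. ennpowr (majorant u g y) q * indicator (centred_cube 1 0) y \<partial>lborel) < \<infinity>"
      using H[of 0 0] by (auto intro: le_less_trans)
    then show "torus_conv_exists f g"
      unfolding u_def by (rule torus_conv_exists_of_majorant[OF f0 g0 ff0 gg0 q(1)])
    show "torus_conv f g \<in> borel_measurable borel"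
      by (rule torus_conv_measurable[OF f0 g0 ff0 gg0])
    have "morrey_norm (ereal q) l (torus_conv f g) \<le> ennreal (2 powr l * (C powr (1 / q) * A * B))"
      using A B norm_torus_conv_le[OF f0 g0 ff0 gg0, folded u_def]
      by (intro morrey_norm_le_of_dyadic[OF q(1) l(1) _ _ H]) auto
    then show "morrey_norm (ereal q) l (torus_conv f g) \<le> ennreal (2 powr l * C powr (1 / q) * A * B)"
      by (simp add: mult_ac)
  qed
qed

lemma Lp_norm_mono_set:
  assumes "S \<subseteq> S'" "S \<in> sets borel" "S' \<in> sets borel" "0 < q"
  shows "Lp_norm (ereal q) (lebesgue_on S) F \<le> Lp_norm (ereal q) (lebesgue_on S') F"
  unfolding Lp_norm_def using assms
  by (auto simp: nn_integral_lebesgue_on intro!: ennpowr_mono nn_integral_mono split: split_indicator)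

lemma mem_morrey_spaceI:
  fixes F :: "real ^ 'n \<Rightarrow> complex"
  assumes F: "F \<in> borel_measurable borel" and q: "0 < q" and fin: "morrey_norm (ereal q) l F < \<infinity>"
  shows "F \<in> morrey_space (ereal q) l"
proof -
  have 0: "(0 :: real ^ 'n) \<in> torus_cube" by (auto simp: torus_cube_def mem_box_cart)
  have sub: "torus_cube \<subseteq> centred_cube 1 (0 :: real ^ 'n)"
    by (rule torus_cube_subset_centred_cube[OF 0]) simp
  have "Lp_norm (ereal q) (lebesgue_on S) F < \<infinity>" if "compact S" "S \<subseteq> torus_cube" for S
  proof -
    have "Lp_norm (ereal q) (lebesgue_on S) F \<le> Lp_norm (ereal q) (lebesgue_on (centred_cube 1 0 \<inter> torus_cube)) F"
      using that sub q by (intro Lp_norm_mono_set) (auto simp: borel_compact)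
    also have "\<dots> = ennreal (1 powr (- l)) * Lp_norm (ereal q) (lebesgue_on (centred_cube 1 0 \<inter> torus_cube)) F"
      by simp
    also have "\<dots> \<le> morrey_norm (ereal q) l F"
      unfolding morrey_norm_def using 0 by (intro SUP_upper2[of 0] SUP_upper2[of 1]) auto
    finally show ?thesis using fin by (rule le_less_trans)
  qed
  then show ?thesis
    using F fin by (auto simp: morrey_space_def Lp_loc_def intro: lborel_imp_lebesgue_on_measurable)
qed

text \<open>Recovers the bound by the norms themselves from bounds by positive numbers above them.\<close>
lemma ennreal_le_mult_of_approx:
  fixes x X Y :: ennreal and c :: real
  assumes "X < \<infinity>" "Y < \<infinity>" "0 \<le> c"
    and approx: "\<And>A B. 0 < A \<Longrightarrow> 0 < B \<Longrightarrow> X \<le> ennreal A \<Longrightarrow> Y \<le> ennreal B \<Longrightarrow> x \<le> ennreal (c * A * B)"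
  shows "x \<le> ennreal c * X * Y"
proof -
  obtain a b where ab: "X = ennreal a" "Y = ennreal b" "0 \<le> a" "0 \<le> b"
    using assms(1,2) by (cases X; cases Y) auto
  \<comment> \<open>The approximating bounds are strictly positive, so zero norms are reached only in the limit.\<close>
  have "((\<lambda>e. ennreal (c * (a + e) * (b + e))) \<longlongrightarrow> ennreal (c * (a + 0) * (b + 0))) (at_right 0)"
    by (intro tendsto_intros)
  moreover have "eventually (\<lambda>e. x \<le> ennreal (c * (a + e) * (b + e))) (at_right 0)"
    using ab by (intro eventually_at_right_less[THEN eventually_mono] approx) (auto intro: ennreal_leI)
  ultimately have "x \<le> ennreal (c * (a + 0) * (b + 0))"
    by (intro tendsto_lowerbound) auto
  then show ?thesis using ab assms(3) by (simp add: ennreal_mult)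
qed

theorem theorem10:
  fixes p p' q :: ereal and l \<gamma> \<alpha> :: real
  assumes "0 < q" and "0 < max q 1" and "max q 1 \<le> p" and "p \<le> \<infinity>"
    and "1 \<le> p'" and "1 / p + 1 / p' = 1"
    and "0 < l" and "ereal l < ereal (real CARD('n::finite)) / q"
    and "0 \<le> \<gamma>" and "ereal \<gamma> \<le> ereal (real CARD('n)) / p"
    and "ereal \<alpha> = ereal \<gamma> - ereal l + ereal (real CARD('n)) / q"
    and "0 < \<alpha>" and "ereal \<alpha> < ereal (real CARD('n)) / p"
  shows "\<exists>c::real. 0 \<le> c \<and>
    (\<forall>T :: (real ^ 'n) set set. dyadic_partition T \<longrightarrow>
      (\<forall>f \<in> morrey_space p \<gamma>. \<forall>g \<in> local_morrey_space p' \<infinity> (- \<alpha>) T.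
         torus_conv_exists f g \<and>
         torus_conv f g \<in> morrey_space q l \<and>
         morrey_norm q l (torus_conv f g)
           \<le> ennreal c * morrey_norm p \<gamma> f * local_morrey_norm p' \<infinity> (- \<alpha>) T g))"
proof -
  \<comment> \<open>The condition \<open>0 < \<alpha> < n/p\<close> leaves no room for \<open>p = \<infinity>\<close>.\<close>
  have "p \<noteq> \<infinity>"
    using assms(12,13) by auto
  have "1 \<le> p" "q \<le> p"
    using assms(3) by (auto intro: order_trans[OF max.cobounded1] order_trans[OF max.cobounded2])
  with \<open>p \<noteq> \<infinity>\<close> \<open>1 \<le> p\<close> obtain P where P: "p = ereal P" "1 \<le> P"
    by (cases p) (auto simp: one_ereal_def)
  obtain q' where q': "q = ereal q'" "0 < q'" "q' \<le> P"
    using assms(1) \<open>q \<le> p\<close> P by (cases q) auto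
  have l: "l < real CARD('n) / q'" and \<alpha>: "\<alpha> = \<gamma> - l + real CARD('n) / q'" "\<alpha> < real CARD('n) / P"
    using assms(8,11,13) P q' by auto
  from convolution_morrey_estimate[OF P(2) q'(2,3) assms(5) assms(6)[unfolded P(1)] assms(7) l \<alpha>]
  obtain c where c: "0 \<le> c" and est: "\<And>(T :: (real ^ 'n) set set) (f :: real ^ 'n \<Rightarrow> complex) g A B. \<lbrakk>dyadic_partition T; 0 < A; 0 < B;
      f \<in> borel_measurable (lebesgue_on torus_cube); g \<in> borel_measurable (lebesgue_on torus_cube);
      morrey_norm p \<gamma> f \<le> ennreal A; local_morrey_norm p' \<infinity> (- \<alpha>) T g \<le> ennreal B\<rbrakk> \<Longrightarrow>
      torus_conv_exists f g \<and> torus_conv f g \<in> borel_measurable borel \<and>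
      morrey_norm q l (torus_conv f g) \<le> ennreal (c * A * B)"
    unfolding P(1) q'(1) by blast
  show ?thesis
  proof (intro exI[of _ c] conjI c allI impI ballI)
    fix T :: "(real ^ 'n) set set" and f g :: "real ^ 'n \<Rightarrow> complex"
    assume T: "dyadic_partition T" and f: "f \<in> morrey_space p \<gamma>" and g: "g \<in> local_morrey_space p' \<infinity> (- \<alpha>) T"
    have fm: "f \<in> borel_measurable (lebesgue_on torus_cube)" "morrey_norm p \<gamma> f < \<infinity>"
      using f by (auto simp: morrey_space_def Lp_loc_def)
    have gm: "g \<in> borel_measurable (lebesgue_on torus_cube)" "local_morrey_norm p' \<infinity> (- \<alpha>) T g < \<infinity>"
      using g by (auto simp: local_morrey_space_def)
    note e = est[OF T _ _ fm(1) gm(1)]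
    show bound: "morrey_norm q l (torus_conv f g) \<le> ennreal c * morrey_norm p \<gamma> f * local_morrey_norm p' \<infinity> (- \<alpha>) T g"
      using e by (intro ennreal_le_mult_of_approx fm gm c) blast
    obtain A B where AB: "0 < A" "0 < B" "morrey_norm p \<gamma> f \<le> ennreal A" "local_morrey_norm p' \<infinity> (- \<alpha>) T g \<le> ennreal B"
    proof
      show "morrey_norm p \<gamma> f \<le> ennreal (enn2real (morrey_norm p \<gamma> f) + 1)"
        "local_morrey_norm p' \<infinity> (- \<alpha>) T g \<le> ennreal (enn2real (local_morrey_norm p' \<infinity> (- \<alpha>) T g) + 1)"
        using fm(2) gm(2) by (auto simp: ennreal_enn2real_if add_increasing2)
    qed (simp_all add: add_nonneg_pos)
    from e[OF AB] show "torus_conv_exists f g" by blast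
    from e[OF AB] have m: "torus_conv f g \<in> borel_measurable borel" "morrey_norm q l (torus_conv f g) < \<infinity>"
      by (auto intro: le_less_trans)
    then show "torus_conv f g \<in> morrey_space q l"
      unfolding q'(1) using q'(2) by (intro mem_morrey_spaceI)
  qed
qed

end
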